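(* Assume that $\mu \colon \mathcal{P}^2_o \to \mathbb{R}^{2\times 2}$ is a measurable valuation which is $\mathrm{GL}(2)$-contravariant, i.e. $\mu(\phi P) = |\det\phi|^{-1}\,\phi^{-t}\,\mu(P)\,\phi^{-1}$ for all $P \in \mathcal{P}^2_o$ and all $\phi \in \mathrm{GL}(2)$. Then there exists $k \in \mathbb{R}$ such that $\mu(P) = k\, M_2(P^* )$ for all $P \in \mathcal{P}^2_o$.
   Context: $\mathcal{P}^2_o$ denotes the set of convex polygons in $\mathbb{R}^2$ containing the origin in their interiors, with the Hausdorff metric topology; "measurable" refers to Borel $\sigma$-algebras. $\phi^{-t}$ is the inverse of the transpose of $\phi$. A map $\mu$ on a family $\mathcal{S}$ of sets is a valuation if $\mu(K \cup L) + \mu(K \cap L) = \mu(K) + \mu(L)$ whenever $K, L, K\cup L, K \cap L \in \mathcal{S}$. The moment matrix is $M_2(P) = \int_P x\,x^t\,dx$ and $P^* = \{y : y^t x \le 1 \ \forall x \in P\}$ is the polar body. *)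

theory Defs
  imports "HOL-Analysis.Analysis"
begin

text \<open>Convex polygons in the plane containing the origin in their interiors.
  A polytope is the convex hull of a finite set; nonempty interior forces it to be
  a (two-dimensional) convex polygon.\<close>
definition polygons_o :: "(real^2) set set" where
  "polygons_o = {P. polytope P \<and> 0 \<in> interior P}"

definition hausdorff_dist :: "(real^2) set \<Rightarrow> (real^2) set \<Rightarrow> real" where
  "hausdorff_dist S T =
     max (SUP x\<in>S. setdist {x} T) (SUP y\<in>T. setdist {y} S)"

definition polygons_o_borel :: "(real^2) set measure" where
  "polygons_o_borel =
     sigma polygons_o {U. openin (Metric_space.mtopology polygons_o hausdorff_dist) U}"

definition is_valuation_on :: "'a set set \<Rightarrow> ('a set \<Rightarrow> 'b::ab_group_add) \<Rightarrow> bool" where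
  "is_valuation_on S \<mu> \<longleftrightarrow>
     (\<forall>K L. K \<in> S \<longrightarrow> L \<in> S \<longrightarrow> K \<union> L \<in> S \<longrightarrow> K \<inter> L \<in> S \<longrightarrow>
        \<mu> (K \<union> L) + \<mu> (K \<inter> L) = \<mu> K + \<mu> L)"

definition GL2_contravariant :: "((real^2) set \<Rightarrow> real^2^2) \<Rightarrow> bool" where
  "GL2_contravariant \<mu> \<longleftrightarrow>
     (\<forall>P\<in>polygons_o. \<forall>\<phi>::real^2^2. invertible \<phi> \<longrightarrow>
        \<mu> ((\<lambda>x. \<phi> *v x) ` P) =
          (1 / \<bar>det \<phi>\<bar>) *\<^sub>R (transpose (matrix_inv \<phi>) ** \<mu> P ** matrix_inv \<phi>))"

definition moment_matrix :: "(real^2) set \<Rightarrow> real^2^2" where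
  "moment_matrix P = (\<chi> i j. integral P (\<lambda>x. x $ i * x $ j))"

definition polar_body :: "(real^2) set \<Rightarrow> (real^2) set" where
  "polar_body P = {y. \<forall>x\<in>P. y \<bullet> x \<le> 1}"

end

theory Submission
  imports Defs
begin

text \<open>
  Passing to polars, \<open>\<nu> P = \<mu> (P\<^sup>*)\<close> is again a valuation, now with
  \<open>\<nu> (\<phi> P) = |det \<phi>| \<phi> (\<nu> P) \<phi>\<^sup>t\<close>. By the valuation property the change of \<open>\<nu>\<close> when a line
  cuts a piece off a polygon depends only on the piece. For triangular pieces it is, by
  covariance, a function of the coordinates \<open>(\<alpha>, \<beta>)\<close> of the apex in the basis formed by the other
  two vertices. Splitting such a triangle by a line through a base vertex gives twisted
  multiplicative equations \<open>h (a b) = h a + a\<^sup>k h b\<close>, whose solutions are multiples of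
  \<open>a\<^sup>k - 1\<close>. Together with the symmetry exchanging the two base
  vertices they leave a single free parameter. If this parameter vanishes, then no triangular
  cut changes \<open>\<nu>\<close>; every cut is a succession of triangular ones (rotate the cutting line about a
  boundary point), so \<open>\<nu>\<close> is constant, and zero by homogeneity. The moment matrix is such
  a valuation and does not vanish, so a suitable multiple of it can be subtracted from \<open>\<nu>\<close> to
  kill the parameter.
\<close>

section \<open>Polygons and polarity\<close>

definition halfplane :: "real^2 \<Rightarrow> (real^2) set" where
  "halfplane n = {x. n \<bullet> x \<le> 1}"

lemma mem_halfplane: "x \<in> halfplane n \<longleftrightarrow> n $ 1 * x $ 1 + n $ 2 * x $ 2 \<le> 1"
  by (simp add: halfplane_def inner_vec_def sum_2)

lemma zero_interior_halfplane: "0 \<in> interior (halfplane n)"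
proof -
  have "open {x. n \<bullet> x < 1}" by (rule open_halfspace_lt)
  then have "{x. n \<bullet> x < 1} \<subseteq> interior (halfplane n)"
    by (intro interior_maximal) (auto simp: halfplane_def)
  then show ?thesis by auto
qed

lemma polyhedron_halfplane: "polyhedron (halfplane n)"
  unfolding halfplane_def by (rule polyhedron_halfspace_le)

lemma polygons_oD:
  assumes "P \<in> polygons_o"
  shows "polytope P" "0 \<in> interior P" "0 \<in> P" "convex P" "compact P" "bounded P" "closed P"
  using assms interior_subset
  by (auto simp: polygons_o_def polytope_imp_convex polytope_imp_compact polytope_imp_bounded
      polytope_imp_closed)

lemma polygons_o_Int: "P \<in> polygons_o \<Longrightarrow> Q \<in> polygons_o \<Longrightarrow> P \<inter> Q \<in> polygons_o"
  by (simp add: polygons_o_def polytope_Int)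

lemma polygons_o_Int_halfplane: "P \<in> polygons_o \<Longrightarrow> P \<inter> halfplane n \<in> polygons_o"
  using polyhedron_Int_polytope[OF polyhedron_halfplane, of P n]
  by (simp add: polygons_o_def zero_interior_halfplane Int_commute)

lemma polygons_o_Inter_halfplanes:
  assumes "finite N" "bounded (\<Inter>(halfplane ` N))"
  shows "\<Inter>(halfplane ` N) \<in> polygons_o"
proof -
  have "polyhedron (\<Inter>(halfplane ` N))"
    using assms polyhedron_halfplane by auto
  moreover have "0 \<in> interior (\<Inter>(halfplane ` N))"
    using assms(1) by (induction N) (auto simp: zero_interior_halfplane)
  ultimately show ?thesis
    using assms(2) by (simp add: polygons_o_def polytope_eq_bounded_polyhedron)
qed

text \<open>Each constraint \<open>a \<bullet> x \<le> b\<close> holds on a ball around the origin,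
  so \<open>b > 0\<close> and it can be scaled to right-hand side 1.\<close>

lemma polygons_o_halfplanes:
  assumes "P \<in> polygons_o"
  obtains N where "finite N" "P = \<Inter>(halfplane ` N)"
proof -
  from polygons_oD[OF assms] have "polyhedron P" by (simp add: polytope_imp_polyhedron)
  then obtain F where F: "finite F" "P = \<Inter>F"
    "\<And>h. h \<in> F \<Longrightarrow> \<exists>a b. a \<noteq> 0 \<and> h = {x. a \<bullet> x \<le> b}"
    unfolding polyhedron_def by blast
  have "\<exists>n. h = halfplane n" if h: "h \<in> F" for h
  proof -
    obtain a b where ab: "a \<noteq> 0" "h = {x. a \<bullet> x \<le> b}" using F(3)[OF h] by blast
    obtain e where e: "e > 0" "cball 0 e \<subseteq> P"
      using polygons_oD(2)[OF assms] mem_interior_cball by blast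
    have "(e / norm a) *\<^sub>R a \<in> h"
      using e ab(1) F(2) h by (auto simp: subset_iff)
    then have "0 < b"
      using e ab by (auto simp: dot_square_norm power2_eq_square intro: less_le_trans[of _ "e * norm a"])
    then have "h = halfplane ((1/b) *\<^sub>R a)"
      using ab by (auto simp: halfplane_def field_simps)
    then show ?thesis by blast
  qed
  then obtain n where n: "\<And>h. h \<in> F \<Longrightarrow> h = halfplane (n h)" by metis
  show thesis
  proof
    show "finite (n ` F)" using F by simp
    show "P = \<Inter>(halfplane ` n ` F)" using F n by (auto simp: image_image)
  qed
qed

lemma polygons_o_image:
  fixes \<phi> :: "real^2^2"
  assumes "P \<in> polygons_o" "invertible \<phi>"
  shows "(*v) \<phi> ` P \<in> polygons_o"
proof -
  have "0 \<in> (*v) \<phi> ` interior P"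
    using polygons_oD(2)[OF assms(1)] by (metis image_eqI matrix_vector_mult_0_right)
  also have "\<dots> = interior ((*v) \<phi> ` P)"
    by (rule interior_injective_linear_image[symmetric])
       (simp_all add: inj_matrix_vector_mult assms)
  finally show ?thesis
    using polygons_oD(1)[OF assms(1)] by (simp add: polygons_o_def polytope_linear_image)
qed

text \<open>Only the generating points of \<open>P\<close> constrain the polar, so it is a finite
  intersection of halfplanes; a ball of radius \<open>e\<close> inside \<open>P\<close> bounds it by
  \<open>1 / e\<close>.\<close>

lemma polar_body_polygons_o:
  assumes "P \<in> polygons_o"
  shows "polar_body P \<in> polygons_o"
proof -
  obtain V where V: "finite V" "P = convex hull V"
    using polygons_oD(1)[OF assms] by (auto simp: polytope_def)
  have "polar_body P = \<Inter>(halfplane ` V)"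
  proof
    show "polar_body P \<subseteq> \<Inter>(halfplane ` V)"
      using V by (auto simp: polar_body_def halfplane_def inner_commute hull_inc)
    show "\<Inter>(halfplane ` V) \<subseteq> polar_body P"
    proof
      fix y assume "y \<in> \<Inter>(halfplane ` V)"
      then have "V \<subseteq> {x. y \<bullet> x \<le> 1}"
        by (auto simp: halfplane_def inner_commute)
      then have "convex hull V \<subseteq> {x. y \<bullet> x \<le> 1}"
        by (rule hull_minimal) (rule convex_halfspace_le)
      then show "y \<in> polar_body P" using V by (auto simp: polar_body_def)
    qed
  qed
  moreover have "bounded (polar_body P)"
  proof -
    obtain e where e: "e > 0" "cball 0 e \<subseteq> P"
      using polygons_oD(2)[OF assms] mem_interior_cball by blast
    have "norm y \<le> 1 / e" if y: "y \<in> polar_body P" for y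
    proof (cases "y = 0")
      case False
      have "(e / norm y) *\<^sub>R y \<in> P" using e False by (auto simp: subset_iff)
      then have "y \<bullet> ((e / norm y) *\<^sub>R y) \<le> 1" using y by (auto simp: polar_body_def)
      then show ?thesis using e False by (simp add: dot_square_norm power2_eq_square field_simps)
    qed (use e in auto)
    then show ?thesis by (auto simp: bounded_iff)
  qed
  ultimately show ?thesis
    using polygons_o_Inter_halfplanes V(1) by simp
qed

text \<open>No separation argument is involved: the normals of the halfplanes defining
  \<open>P\<close> are themselves points of the polar.\<close>

lemma polar_polar:
  assumes "P \<in> polygons_o"
  shows "polar_body (polar_body P) = P"
proof
  show "P \<subseteq> polar_body (polar_body P)"
    by (auto simp: polar_body_def inner_commute)
  obtain N where N: "finite N" "P = \<Inter>(halfplane ` N)" by (rule polygons_o_halfplanes[OF assms])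
  then have "N \<subseteq> polar_body P" by (auto simp: polar_body_def halfplane_def)
  then show "polar_body (polar_body P) \<subseteq> P"
    using N by (auto simp: polar_body_def halfplane_def inner_commute)
qed

lemma polar_Un: "polar_body (K \<union> L) = polar_body K \<inter> polar_body L"
  by (auto simp: polar_body_def)

text \<open>If \<open>y\<close> is in neither polar, \<open>K\<close> and \<open>L\<close> both meet
  the open halfplane \<open>y \<bullet> p > 1\<close>. The segment between two such points lies in
  the convex union, so by connectedness it passes through \<open>K \<inter> L\<close> inside that
  halfplane.\<close>

lemma polar_Int:
  assumes "closed K" "closed L" "convex (K \<union> L)"
  shows "polar_body (K \<inter> L) = polar_body K \<union> polar_body L"
proof
  show "polar_body K \<union> polar_body L \<subseteq> polar_body (K \<inter> L)" by (auto simp: polar_body_def)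
  show "polar_body (K \<inter> L) \<subseteq> polar_body K \<union> polar_body L"
  proof (rule subsetI, rule ccontr)
    fix y assume y: "y \<in> polar_body (K \<inter> L)" "y \<notin> polar_body K \<union> polar_body L"
    then obtain x z where xz: "x \<in> K" "y \<bullet> x > 1" "z \<in> L" "y \<bullet> z > 1"
      by (auto simp: polar_body_def not_le)
    have "closed_segment x z \<subseteq> K \<union> L"
      using xz assms(3) by (simp add: closed_segment_subset)
    then have "\<exists>p \<in> closed_segment x z. p \<in> K \<inter> L"
      using connected_closedD[OF connected_segment(1)[of x z], of K L] assms xz by blast
    then obtain p where p: "p \<in> closed_segment x z" "p \<in> K \<inter> L" by blast
    have "closed_segment x z \<subseteq> {p. y \<bullet> p > 1}"
      using xz convex_halfspace_gt[of 1 y] by (intro closed_segment_subset) auto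
    then show False using p y(1) by (force simp: polar_body_def)
  qed
qed

lemma matrix_inv_mult:
  fixes \<phi> :: "real^2^2"
  assumes "invertible \<phi>"
  shows "\<phi> ** matrix_inv \<phi> = mat 1" "matrix_inv \<phi> ** \<phi> = mat 1"
  using someI_ex[of "\<lambda>A'. \<phi> ** A' = mat 1 \<and> A' ** \<phi> = mat 1"] assms
  unfolding matrix_inv_def invertible_def by auto

lemma polar_image:
  fixes \<phi> :: "real^2^2"
  assumes "invertible \<phi>"
  shows "polar_body ((*v) \<phi> ` P) = (*v) (transpose (matrix_inv \<phi>)) ` polar_body P"
proof -
  have *: "transpose (matrix_inv \<phi>) ** transpose \<phi> = mat 1"
    using matrix_inv_mult[OF assms] by (metis matrix_transpose_mul transpose_mat)
  have "y \<in> polar_body ((*v) \<phi> ` P) \<longleftrightarrow> transpose \<phi> *v y \<in> polar_body P" for y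
    by (auto simp: polar_body_def dot_lmul_matrix[symmetric] transpose_matrix_vector)
  moreover have "y = transpose (matrix_inv \<phi>) *v (transpose \<phi> *v y)" for y
    by (metis * matrix_vector_mul_assoc matrix_vector_mul_lid)
  moreover have "transpose \<phi> *v (transpose (matrix_inv \<phi>) *v y) = y" for y
    using * matrix_left_right_inverse[of "transpose \<phi>" "transpose (matrix_inv \<phi>)"]
    by (metis matrix_vector_mul_assoc matrix_vector_mul_lid)
  ultimately show ?thesis by (metis (no_types, lifting) image_iff subsetI subset_antisym)
qed

section \<open>Covariant valuations as polar duals of contravariant ones\<close>

locale covariant_valuation =
  fixes \<nu> :: "(real^2) set \<Rightarrow> real^2^2"
  assumes valuation: "is_valuation_on polygons_o \<nu>"
    and covariant: "\<And>P \<phi>. P \<in> polygons_o \<Longrightarrow> invertible \<phi> \<Longrightarrow>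
      \<nu> ((*v) \<phi> ` P) = \<bar>det \<phi>\<bar> *\<^sub>R (\<phi> ** \<nu> P ** transpose \<phi>)"

text \<open>Polarity exchanges unions and intersections and turns \<open>\<phi>\<close> into its
  inverse transpose, whose determinant is the reciprocal one.\<close>

lemma covariant_valuation_polar:
  assumes "is_valuation_on polygons_o \<mu>" "GL2_contravariant \<mu>"
  shows "covariant_valuation (\<lambda>P. \<mu> (polar_body P))"
proof
  show "is_valuation_on polygons_o (\<lambda>P. \<mu> (polar_body P))"
    unfolding is_valuation_on_def
  proof (intro allI impI)
    fix K L :: "(real^2) set"
    assume KL: "K \<in> polygons_o" "L \<in> polygons_o" "K \<union> L \<in> polygons_o" "K \<inter> L \<in> polygons_o"
    have Int: "polar_body (K \<inter> L) = polar_body K \<union> polar_body L"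
      by (intro polar_Int polygons_oD KL)
    show "\<mu> (polar_body (K \<union> L)) + \<mu> (polar_body (K \<inter> L)) = \<mu> (polar_body K) + \<mu> (polar_body L)"
      using KL[THEN polar_body_polygons_o] assms(1)
      unfolding Int polar_Un is_valuation_on_def
      by (simp add: add.commute)
  qed
  fix P and \<phi> :: "real^2^2" assume P: "P \<in> polygons_o" and \<phi>: "invertible \<phi>"
  let ?\<psi> = "transpose (matrix_inv \<phi>)"
  have mi: "\<phi> ** matrix_inv \<phi> = mat 1" "matrix_inv \<phi> ** \<phi> = mat 1"
    using matrix_inv_mult[OF \<phi>] by auto
  have inv: "invertible ?\<psi>"
    using mi by (metis invertible_def transpose_invertible)
  have inv_eq: "matrix_inv ?\<psi> = transpose \<phi>"
    using matrix_inv_mult[OF inv] mi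
    by (metis matrix_mul_assoc matrix_mul_lid matrix_mul_rid matrix_transpose_mul transpose_mat)
  have "det \<phi> * det ?\<psi> = 1"
    using mi(1) by (metis det_I det_mul det_transpose)
  then have det: "1 / \<bar>det ?\<psi>\<bar> = \<bar>det \<phi>\<bar>"
    by (metis abs_1 abs_mult divide_eq_eq mult_eq_0_iff mult.commute abs_zero zero_neq_one)
  show "\<mu> (polar_body ((*v) \<phi> ` P))
      = \<bar>det \<phi>\<bar> *\<^sub>R (\<phi> ** \<mu> (polar_body P) ** transpose \<phi>)"
    using assms(2) inv polar_body_polygons_o[OF P]
    by (simp add: polar_image[OF \<phi>] GL2_contravariant_def inv_eq det[symmetric]
        del: transpose_matrix_vector)
qed

section \<open>Cutting off triangles\<close>

lemma halfplane_vector: "x \<in> halfplane (vector [a, b]) \<longleftrightarrow> a * x $ 1 + b * x $ 2 \<le> 1"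
  by (simp add: mem_halfplane)

lemma halfplane_1: "x \<in> halfplane 1 \<longleftrightarrow> x $ 1 + x $ 2 \<le> 1"
  by (simp add: mem_halfplane)

lemma matrix_vector_mult_2:
  fixes A :: "real^2^2"
  shows "(A *v x) $ i = A $ i $ 1 * x $ 1 + A $ i $ 2 * x $ 2"
  by (simp add: matrix_vector_mult_def sum_2)

lemma conjugate_2:
  fixes A B :: "real^2^2"
  shows "(A ** B ** transpose A) $ i $ j =
    A$i$1 * B$1$1 * A$j$1 + A$i$1 * B$1$2 * A$j$2 + A$i$2 * B$2$1 * A$j$1 + A$i$2 * B$2$2 * A$j$2"
  by (simp add: matrix_matrix_mult_def sum_2 transpose_def algebra_simps)

lemma image_vimage_invertible:
  fixes \<phi> :: "real^2^2"
  assumes "invertible \<phi>"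
  shows "(*v) \<phi> ` ((*v) \<phi> -` P) = P"
  using matrix_inv_mult(1)[OF assms]
  by (auto simp: image_iff) (metis matrix_vector_mul_assoc matrix_vector_mul_lid)

lemma polygons_o_vimage:
  fixes \<phi> :: "real^2^2"
  assumes "P \<in> polygons_o" "invertible \<phi>"
  shows "(*v) \<phi> -` P \<in> polygons_o"
proof -
  have "(*v) \<phi> -` P = (*v) (matrix_inv \<phi>) ` P"
    using matrix_inv_mult[OF assms(2)]
    by (auto simp: image_iff matrix_vector_mul_assoc) (metis matrix_vector_mul_assoc matrix_vector_mul_lid)
  moreover have "invertible (matrix_inv \<phi>)"
    using matrix_inv_mult[OF assms(2)] by (auto simp: invertible_def)
  ultimately show ?thesis using polygons_o_image assms(1) by simp
qed

text \<open>The wedge at the apex \<open>(\<alpha>, \<beta>)\<close> whose sides pass through \<open>(1, 0)\<close> and \<open>(0, 1)\<close>; outside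
  \<open>halfplane 1\<close> it is the triangle with these three vertices.\<close>
definition ear :: "real \<Rightarrow> real \<Rightarrow> (real^2) set" where
  "ear \<alpha> \<beta> = halfplane (vector [1, (1 - \<alpha>) / \<beta>]) \<inter> halfplane (vector [(1 - \<beta>) / \<alpha>, 1])"

text \<open>Any polygon in \<open>polygons_o\<close> agreeing with the ear outside \<open>halfplane 1\<close> would do.\<close>
definition ear_polygon :: "real \<Rightarrow> real \<Rightarrow> (real^2) set" where
  "ear_polygon \<alpha> \<beta> = ear \<alpha> \<beta> \<inter> halfplane (vector [-1, 0]) \<inter> halfplane (vector [0, -1])"

lemma mem_ear:
  assumes "\<alpha> > 0" "\<beta> > 0"
  shows "x \<in> ear \<alpha> \<beta> \<longleftrightarrow>
    \<beta> * x $ 1 + (1 - \<alpha>) * x $ 2 \<le> \<beta> \<and> (1 - \<beta>) * x $ 1 + \<alpha> * x $ 2 \<le> \<alpha>"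
  using assms by (simp add: ear_def halfplane_vector field_simps)

text \<open>Combining \<open>x $ 1 + x $ 2 > 1\<close> with one side of the wedge eliminates a
  coordinate and leaves \<open>\<alpha> + \<beta> - 1\<close> times the other. Hence the lower
  bounds in \<open>ear_polygon\<close> are invisible beyond \<open>halfplane 1\<close>.\<close>

lemma ear_pos:
  assumes "\<alpha> > 0" "\<beta> > 0" "\<alpha> + \<beta> > 1" "x \<in> ear \<alpha> \<beta>" "x \<notin> halfplane 1"
  shows "x $ 1 > 0" "x $ 2 > 0"
proof -
  from assms have *: "\<beta> * x $ 1 + (1 - \<alpha>) * x $ 2 \<le> \<beta>" "(1 - \<beta>) * x $ 1 + \<alpha> * x $ 2 \<le> \<alpha>"
    "x $ 1 + x $ 2 > 1"
    by (auto simp: mem_ear halfplane_1)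
  have "\<alpha> < \<alpha> * (x$1 + x$2)" "\<beta> < \<beta> * (x$1 + x$2)" using * assms by simp_all
  then have "0 < (\<alpha> + \<beta> - 1) * x $ 1" "0 < (\<alpha> + \<beta> - 1) * x $ 2"
    using * by (simp_all add: algebra_simps)
  then show "x $ 1 > 0" "x $ 2 > 0" using assms by (simp_all add: zero_less_mult_iff)
qed

lemma ear_le_1:
  assumes "\<alpha> > 0" "\<beta> > 0" "\<alpha> + \<beta> > 1" "x \<in> ear \<alpha> \<beta>" "x \<notin> halfplane 1"
  shows "x $ 1 \<le> max 1 \<alpha>"
proof -
  from assms have *: "\<beta> * x $ 1 + (1 - \<alpha>) * x $ 2 \<le> \<beta>" "(1 - \<beta>) * x $ 1 + \<alpha> * x $ 2 \<le> \<alpha>"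
    by (auto simp: mem_ear)
  show ?thesis
  proof (cases "\<alpha> \<le> 1")
    case True
    then have "0 \<le> (1 - \<alpha>) * x $ 2" using ear_pos[OF assms] by simp
    with * have "\<beta> * x $ 1 \<le> \<beta>" by linarith
    then show ?thesis using assms by simp
  next
    case False
    \<comment> \<open>The weights \<open>\<alpha>\<close> and \<open>\<alpha> - 1\<close> make the
      terms in \<open>x $ 2\<close> cancel.\<close>
    have "\<alpha> * (\<beta> * x $ 1 + (1 - \<alpha>) * x $ 2) + (\<alpha> - 1) * ((1 - \<beta>) * x $ 1 + \<alpha> * x $ 2)
        \<le> \<alpha> * \<beta> + (\<alpha> - 1) * \<alpha>"
      using * assms False by (intro add_mono mult_left_mono) auto
    then have "(\<alpha> + \<beta> - 1) * x $ 1 \<le> (\<alpha> + \<beta> - 1) * \<alpha>" by (simp add: algebra_simps)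
    then show ?thesis using assms by simp
  qed
qed

lemma swap_ear:
  assumes "\<alpha> > 0" "\<beta> > 0"
  shows "(vector [vector [0, 1], vector [1, 0]] :: real^2^2) *v x \<in> ear \<alpha> \<beta> \<longleftrightarrow> x \<in> ear \<beta> \<alpha>"
  using assms by (auto simp: mem_ear matrix_vector_mult_2 algebra_simps)

lemma ear_le_2:
  assumes "\<alpha> > 0" "\<beta> > 0" "\<alpha> + \<beta> > 1" "x \<in> ear \<alpha> \<beta>" "x \<notin> halfplane 1"
  shows "x $ 2 \<le> max 1 \<beta>"
proof -
  let ?S = "(vector [vector [0, 1], vector [1, 0]] :: real^2^2)"
  have "?S *v x \<in> ear \<beta> \<alpha>" "?S *v x \<notin> halfplane 1"
    using assms by (auto simp: swap_ear halfplane_1 matrix_vector_mult_2)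
  then have "(?S *v x) $ 1 \<le> max 1 \<beta>" using assms by (intro ear_le_1) auto
  then show ?thesis by (simp add: matrix_vector_mult_2)
qed

text \<open>Boundedness inside \<open>halfplane 1\<close> comes from the lower bounds -1 on both
  coordinates, beyond it from the triangle.\<close>

lemma ear_polygon:
  assumes "\<alpha> > 0" "\<beta> > 0" "\<alpha> + \<beta> > 1"
  shows "ear_polygon \<alpha> \<beta> \<in> polygons_o"
proof -
  have "\<bar>x $ 1\<bar> \<le> max 2 \<alpha> \<and> \<bar>x $ 2\<bar> \<le> max 2 \<beta>" if "x \<in> ear_polygon \<alpha> \<beta>" for x
    using that ear_pos[OF assms] ear_le_1[OF assms] ear_le_2[OF assms]
    by (cases "x \<in> halfplane 1") (force simp: ear_polygon_def halfplane_vector halfplane_1)+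
  then have "norm x \<le> max 2 \<alpha> + max 2 \<beta>" if "x \<in> ear_polygon \<alpha> \<beta>" for x
    using that norm_le_l1_cart[of x] by (fastforce simp: sum_2)
  then have "bounded (ear_polygon \<alpha> \<beta>)" by (auto simp: bounded_iff)
  moreover have "ear_polygon \<alpha> \<beta> = \<Inter>(halfplane ` {vector [1, (1 - \<alpha>) / \<beta>],
      vector [(1 - \<beta>) / \<alpha>, 1], vector [-1, 0], vector [0, -1]})"
    by (auto simp: ear_polygon_def ear_def)
  ultimately show ?thesis
    using polygons_o_Inter_halfplanes[of "{vector [1, (1 - \<alpha>) / \<beta>],
      vector [(1 - \<beta>) / \<alpha>, 1], vector [-1, 0], vector [0, -1]}"] by simp
qed

lemma ear_polygon_Diff:
  assumes "\<alpha> > 0" "\<beta> > 0" "\<alpha> + \<beta> > 1"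
  shows "ear_polygon \<alpha> \<beta> - halfplane 1 = ear \<alpha> \<beta> - halfplane 1"
  using ear_pos[OF assms] by (force simp: ear_polygon_def halfplane_vector)

section \<open>Localisation of cuts and the splitting relation\<close>

context covariant_valuation
begin

definition cut :: "real^2 \<Rightarrow> (real^2) set \<Rightarrow> real^2^2" where
  "cut n K = \<nu> K - \<nu> (K \<inter> halfplane n)"

lemma valuationD:
  "K \<in> polygons_o \<Longrightarrow> L \<in> polygons_o \<Longrightarrow> K \<union> L \<in> polygons_o \<Longrightarrow> K \<inter> L \<in> polygons_o \<Longrightarrow>
    \<nu> (K \<union> L) + \<nu> (K \<inter> L) = \<nu> K + \<nu> L"
  using valuation by (auto simp: is_valuation_on_def)

text \<open>By the inclusion \<open>K\<close> is the union of \<open>K \<inter> halfplane n\<close>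
  and \<open>K \<inter> L\<close>, and the valuation property is applied to these two
  pieces.\<close>

lemma cut_Int:
  assumes "K \<in> polygons_o" "L \<in> polygons_o" "K - halfplane n \<subseteq> L"
  shows "cut n (K \<inter> L) = cut n K"
proof -
  let ?H = "halfplane n"
  have eq: "(K \<inter> ?H) \<union> (K \<inter> L) = K" "(K \<inter> ?H) \<inter> (K \<inter> L) = K \<inter> L \<inter> ?H"
    using assms(3) by auto
  have "\<nu> K + \<nu> (K \<inter> L \<inter> ?H) = \<nu> (K \<inter> ?H) + \<nu> (K \<inter> L)"
    using valuationD[of "K \<inter> ?H" "K \<inter> L"] assms
    unfolding eq by (simp add: polygons_o_Int polygons_o_Int_halfplane)
  then show ?thesis by (simp add: cut_def algebra_simps)
qed

lemma cut_cong:
  assumes "K \<in> polygons_o" "L \<in> polygons_o" "K - halfplane n = L - halfplane n"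
  shows "cut n K = cut n L"
  using cut_Int[of K L n] cut_Int[of L K n] assms by (auto simp: Int_commute)

text \<open>Preimages are convenient because membership in them is a substitution: halfplanes and
  ears transform by rewriting their coefficients.\<close>

lemma cut_vimage:
  assumes "K \<in> polygons_o" "invertible \<phi>" "(*v) \<phi> -` halfplane n = halfplane m"
  shows "cut n K = \<bar>det \<phi>\<bar> *\<^sub>R (\<phi> ** cut m ((*v) \<phi> -` K) ** transpose \<phi>)"
proof -
  have *: "\<nu> L = \<bar>det \<phi>\<bar> *\<^sub>R (\<phi> ** \<nu> ((*v) \<phi> -` L) ** transpose \<phi>)" if "L \<in> polygons_o" for L
    using covariant[OF polygons_o_vimage[OF that assms(2)] assms(2)]
    unfolding image_vimage_invertible[OF assms(2)] .
  show ?thesis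
    unfolding cut_def *[OF assms(1)] *[OF polygons_o_Int_halfplane[OF assms(1)]]
    by (simp add: vec_eq_iff conjugate_2 assms(3) algebra_simps)
qed

definition ear_cut :: "real \<Rightarrow> real \<Rightarrow> real^2^2" where
  "ear_cut \<alpha> \<beta> = cut 1 (ear_polygon \<alpha> \<beta>)"

lemma cut_eq_ear_cut:
  assumes "\<alpha> > 0" "\<beta> > 0" "\<alpha> + \<beta> > 1"
    and "K \<in> polygons_o" "K - halfplane 1 = ear \<alpha> \<beta> - halfplane 1"
  shows "cut 1 K = ear_cut \<alpha> \<beta>"
  unfolding ear_cut_def using assms by (intro cut_cong ear_polygon) (simp_all add: ear_polygon_Diff)

lemma ear_cut_swap:
  assumes "\<alpha> > 0" "\<beta> > 0" "\<alpha> + \<beta> > 1"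
  shows "ear_cut \<beta> \<alpha> $ 1 $ 1 = ear_cut \<alpha> \<beta> $ 2 $ 2" "ear_cut \<beta> \<alpha> $ 1 $ 2 = ear_cut \<alpha> \<beta> $ 2 $ 1"
    "ear_cut \<beta> \<alpha> $ 2 $ 1 = ear_cut \<alpha> \<beta> $ 1 $ 2" "ear_cut \<beta> \<alpha> $ 2 $ 2 = ear_cut \<alpha> \<beta> $ 1 $ 1"
proof -
  let ?S = "vector [vector [0, 1], vector [1, 0]] :: real^2^2"
  have inv: "invertible ?S" by (simp add: invertible_det_nz det_2)
  have H: "(*v) ?S -` halfplane 1 = halfplane 1"
    by (auto simp: halfplane_1 matrix_vector_mult_2)
  have "cut 1 ((*v) ?S -` ear_polygon \<beta> \<alpha>) = ear_cut \<alpha> \<beta>"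
  proof (rule cut_eq_ear_cut)
    show "(*v) ?S -` ear_polygon \<beta> \<alpha> \<in> polygons_o"
      using assms inv by (intro polygons_o_vimage ear_polygon) auto
    have "(*v) ?S -` ear_polygon \<beta> \<alpha> = ear_polygon \<alpha> \<beta>"
      using assms by (auto simp: ear_polygon_def swap_ear halfplane_vector matrix_vector_mult_2)
    then show "(*v) ?S -` ear_polygon \<beta> \<alpha> - halfplane 1 = ear \<alpha> \<beta> - halfplane 1"
      using ear_polygon_Diff assms by simp
  qed (use assms in auto)
  then have "ear_cut \<beta> \<alpha> = ?S ** ear_cut \<alpha> \<beta> ** transpose ?S"
    using cut_vimage[OF ear_polygon inv H, of \<beta> \<alpha>] assms by (simp add: ear_cut_def det_2)
  then show "ear_cut \<beta> \<alpha> $ 1 $ 1 = ear_cut \<alpha> \<beta> $ 2 $ 2" "ear_cut \<beta> \<alpha> $ 1 $ 2 = ear_cut \<alpha> \<beta> $ 2 $ 1"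
    "ear_cut \<beta> \<alpha> $ 2 $ 1 = ear_cut \<alpha> \<beta> $ 1 $ 2" "ear_cut \<beta> \<alpha> $ 2 $ 2 = ear_cut \<alpha> \<beta> $ 1 $ 1"
    by (simp_all add: conjugate_2)
qed

text \<open>The point \<open>(x, y)\<close> lies on the side from \<open>(1, 0)\<close> to the apex,
  and the line through it and \<open>(0, 1)\<close> splits the triangle in two. The part next to the
  base has apex \<open>(x, y)\<close>. The other part has base vertices \<open>(x, y)\<close> and
  \<open>(0, 1)\<close>, the columns of the matrix; in that basis its apex is
  \<open>(\<alpha> / x, \<beta> * (1 - t) / x)\<close>.\<close>

lemma ear_cut_split:
  fixes \<alpha> \<beta> t :: real
  defines "x \<equiv> 1 - t + t * \<alpha>" and "y \<equiv> t * \<beta>"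
  assumes "\<alpha> > 0" "\<beta> > 0" "\<alpha> + \<beta> > 1" and t: "0 < t" "t < 1"
  shows "ear_cut \<alpha> \<beta> = ear_cut x y + x *\<^sub>R ((vector [vector [x, 0], vector [y, 1]]) **
    ear_cut (\<alpha> / x) (\<beta> * (1 - t) / x) ** transpose (vector [vector [x, 0], vector [y, 1]]))"
proof -
  let ?N = "vector [vector [x, 0], vector [y, 1]] :: real^2^2"
  let ?p = "\<alpha> / x" let ?q = "\<beta> * (1 - t) / x"
  let ?n = "vector [(1 - y) / x, 1] :: real^2"
  let ?K = "ear_polygon \<alpha> \<beta>"
  have xy: "x > 0" "y > 0" "x + y > 1"
  proof -
    show "x > 0" "y > 0" using assms by (auto simp: x_def y_def intro: add_pos_pos)
    have "x + y = 1 + t * (\<alpha> + \<beta> - 1)" by (simp add: x_def y_def algebra_simps)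
    then show "x + y > 1" using assms by simp
  qed
  have pq: "?p > 0" "?q > 0" "?p + ?q > 1"
  proof -
    show "?p > 0" "?q > 0" using assms xy by auto
    have "\<alpha> + \<beta> * (1 - t) - x = (1 - t) * (\<alpha> + \<beta> - 1)" by (simp add: x_def algebra_simps)
    also have "\<dots> > 0" using assms by simp
    finally show "?p + ?q > 1" using xy by (simp add: field_simps)
  qed
  \<comment> \<open>Among the lines through \<open>(0, 1)\<close>, the one of \<open>?n\<close> runs
    between the side of the ear and the base line.\<close>
  have slope: "(1 - \<beta>) / \<alpha> < (1 - y) / x"
  proof -
    have "\<alpha> * (1 - y) - (1 - \<beta>) * x = (1 - t) * (\<alpha> + \<beta> - 1)"
      by (simp add: x_def y_def algebra_simps)
    also have "\<dots> > 0" using assms by simp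
    finally show ?thesis using xy assms by (simp add: field_simps)
  qed
  have slope1: "(1 - y) / x < 1" using xy by (simp add: field_simps)
  \<comment> \<open>Since \<open>(x, y)\<close> lies on the side through \<open>(1, 0)\<close>, both
    small triangles inherit that side with the same coefficient.\<close>
  have first: "(1 - x) / y = (1 - \<alpha>) / \<beta>"
    using t assms by (simp add: x_def y_def field_simps)
  have first': "(1 - ?p) / ?q = (1 - \<alpha>) / \<beta>"
    using t assms xy(1) by (simp add: divide_simps) (simp add: x_def algebra_simps)
  have K: "?K \<in> polygons_o" using assms by (intro ear_polygon)
  have sub: "?K \<inter> halfplane 1 \<subseteq> halfplane ?n"
  proof
    fix z assume "z \<in> ?K \<inter> halfplane 1"
    then have z: "(1 - \<beta>) / \<alpha> * z $ 1 + z $ 2 \<le> 1" "z $ 1 + z $ 2 \<le> 1"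
      by (auto simp: ear_polygon_def ear_def halfplane_vector halfplane_1)
    show "z \<in> halfplane ?n"
    proof (cases "z $ 1 \<ge> 0")
      case True
      then have "(1 - y) / x * z $ 1 \<le> 1 * z $ 1" using slope1 by (intro mult_right_mono) auto
      then show ?thesis using z by (simp add: halfplane_vector)
    next
      case False
      then have "(1 - y) / x * z $ 1 \<le> (1 - \<beta>) / \<alpha> * z $ 1"
        using slope by (intro mult_right_mono_neg) auto
      then show ?thesis using z by (simp add: halfplane_vector)
    qed
  qed
  \<comment> \<open>Cutting with \<open>?n\<close> first removes nothing from
    \<open>halfplane 1\<close>, so the cut telescopes.\<close>
  have step1: "ear_cut \<alpha> \<beta> = cut ?n ?K + cut 1 (?K \<inter> halfplane ?n)"
  proof -
    have "?K \<inter> halfplane ?n \<inter> halfplane 1 = ?K \<inter> halfplane 1" using sub by auto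
    then show ?thesis by (simp add: ear_cut_def cut_def)
  qed
  have step2: "cut 1 (?K \<inter> halfplane ?n) = ear_cut x y"
  proof (rule cut_eq_ear_cut[OF xy polygons_o_Int_halfplane[OF K]])
    have "z \<in> ear \<alpha> \<beta> \<and> z \<in> halfplane ?n \<longleftrightarrow> z \<in> ear x y" if z: "z \<notin> halfplane 1" for z
    proof
      assume "z \<in> ear \<alpha> \<beta> \<and> z \<in> halfplane ?n"
      then show "z \<in> ear x y" by (simp add: ear_def first)
    next
      assume e: "z \<in> ear x y"
      have "(1 - \<beta>) / \<alpha> * z $ 1 \<le> (1 - y) / x * z $ 1"
        using slope ear_pos[OF xy e z] by (intro mult_right_mono) auto
      then show "z \<in> ear \<alpha> \<beta> \<and> z \<in> halfplane ?n"
        using e by (simp add: ear_def first halfplane_vector)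
    qed
    then show "?K \<inter> halfplane ?n - halfplane 1 = ear x y - halfplane 1"
      using ear_polygon_Diff[OF assms(3-5)] by blast
  qed
  have inv: "invertible ?N" using xy by (simp add: invertible_det_nz det_2)
  have H: "(*v) ?N -` halfplane ?n = halfplane 1"
    using xy by (auto simp: halfplane_1 halfplane_vector matrix_vector_mult_2 field_simps)
  have "cut 1 ((*v) ?N -` ?K) = ear_cut ?p ?q"
  proof (rule cut_eq_ear_cut[OF pq polygons_o_vimage[OF K inv]])
    have ear: "?N *v z \<in> ear \<alpha> \<beta> \<longleftrightarrow> z \<in> ear ?p ?q" for z
    proof -
      have c1: "x + (1 - \<alpha>) / \<beta> * y = 1"
        using first xy by (simp add: field_simps)
      have c2: "(1 - \<beta>) / \<alpha> * x + y = (1 - ?q) / ?p"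
        using assms(3) xy by (simp add: divide_simps) (simp add: x_def y_def algebra_simps)
      have "(?N *v z) $ 1 + (1 - \<alpha>) / \<beta> * (?N *v z) $ 2
          = (x + (1 - \<alpha>) / \<beta> * y) * z $ 1 + (1 - \<alpha>) / \<beta> * z $ 2"
        by (simp add: matrix_vector_mult_2 algebra_simps add_divide_distrib)
      then have 1: "1 * (?N *v z) $ 1 + (1 - \<alpha>) / \<beta> * (?N *v z) $ 2
          = 1 * z $ 1 + (1 - \<alpha>) / \<beta> * z $ 2"
        unfolding c1 by simp
      have "(1 - \<beta>) / \<alpha> * (?N *v z) $ 1 + (?N *v z) $ 2
          = ((1 - \<beta>) / \<alpha> * x + y) * z $ 1 + z $ 2"
        by (simp add: matrix_vector_mult_2 algebra_simps add_divide_distrib)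
      then have 2: "(1 - \<beta>) / \<alpha> * (?N *v z) $ 1 + 1 * (?N *v z) $ 2
          = (1 - ?q) / ?p * z $ 1 + 1 * z $ 2"
        unfolding c2 by simp
      show ?thesis
        unfolding ear_def Int_iff halfplane_vector first' 1 2 ..
    qed
    have box: "?N *v z \<in> halfplane (vector [-1, 0]) \<and> ?N *v z \<in> halfplane (vector [0, -1])"
      if "z \<in> ear ?p ?q" "z \<notin> halfplane 1" for z
      using ear_pos[OF pq that] xy by (simp add: halfplane_vector matrix_vector_mult_2)
        (smt (verit) mult_pos_pos)
    show "(*v) ?N -` ?K - halfplane 1 = ear ?p ?q - halfplane 1"
      using ear box by (auto simp: ear_polygon_def)
  qed
  then have "cut ?n ?K = x *\<^sub>R (?N ** ear_cut ?p ?q ** transpose ?N)"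
    using cut_vimage[OF K inv H] xy by (simp add: det_2)
  with step1 step2 show ?thesis by (simp add: add.commute)
qed

end

section \<open>The functional equation for triangular cuts\<close>

text \<open>Expand \<open>h (a * a0)\<close> and \<open>h (a0 * a)\<close>, compare, and solve for
  \<open>h a\<close>.\<close>

lemma twisted_cocycle:
  fixes h :: "real \<Rightarrow> real"
  assumes "\<And>a b. a \<in> J \<Longrightarrow> b \<in> J \<Longrightarrow> h (a * b) = h a + a ^ k * h b"
    and "a0 \<in> J" "a0 ^ k \<noteq> 1"
  shows "\<exists>\<kappa>. \<forall>a\<in>J. h a = \<kappa> * (a ^ k - 1)"
proof (intro exI ballI)
  fix a assume "a \<in> J"
  then have "h a + a ^ k * h a0 = h a0 + a0 ^ k * h a"
    using assms(1)[of a a0] assms(1)[of a0 a] assms(2) by (simp add: mult.commute)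
  then show "h a = h a0 / (a0 ^ k - 1) * (a ^ k - 1)"
    using assms(3) by (simp add: field_simps)
qed

context covariant_valuation
begin

text \<open>Here the apex runs along the line through \<open>(1, 0)\<close> and \<open>(0, c)\<close>; these lines are preserved by
  the base change of \<open>ear_cut_split\<close>, which multiplies first coordinates.\<close>
lemma ear_cut_line_mult:
  assumes c: "c < 0 \<or> c > 1" and a: "a > 0" "(1 - a) * c > 0" and b: "b > 0" "(1 - b) * c > 0"
  shows "ear_cut (a * b) (c * (1 - a * b)) = ear_cut a (c * (1 - a)) +
    a *\<^sub>R (vector [vector [a, 0], vector [c * (1 - a), 1]] ** ear_cut b (c * (1 - b)) **
      transpose (vector [vector [a, 0], vector [c * (1 - a), 1]]))"
proof -
  let ?\<alpha> = "a * b"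
  \<comment> \<open>Chosen so that the intermediate point of the splitting has first coordinate
    \<open>a\<close>.\<close>
  define t where "t = (1 - a) / (1 - a * b)"
  let ?\<beta> = "c * (1 - a * b)"
  have cases: "c < 0 \<and> a > 1 \<and> b > 1 \<or> c > 1 \<and> a < 1 \<and> b < 1"
    using assms by (auto simp: zero_less_mult_iff)
  then have ab: "c < 0 \<and> a * b > 1 \<and> a < a * b \<or> c > 1 \<and> a * b < 1 \<and> a * b < a"
  proof (elim disjE conjE)
    assume "c < 0" "a > 1" "b > 1"
    then show ?thesis using mult_strict_left_mono[of 1 b a] less_1_mult[of a b] by simp
  next
    assume "c > 1" "a < 1" "b < 1"
    then show ?thesis using mult_strict_left_mono[of b 1 a] a by linarith
  qed
  have ne: "1 - a * b \<noteq> 0" using ab by auto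
  have t: "0 < t" "t < 1"
    using ab cases by (auto simp: t_def divide_simps)
  have tt: "t * (1 - a * b) = 1 - a" using ne by (simp add: t_def)
  have \<beta>: "0 < ?\<beta>" using ab by (auto simp: zero_less_mult_iff)
  have "?\<alpha> + ?\<beta> - 1 = (1 - a * b) * (c - 1)" by (simp add: algebra_simps)
  also have "\<dots> > 0" using ab by (auto simp: zero_less_mult_iff)
  finally have sum: "?\<alpha> + ?\<beta> > 1" by simp
  have x: "1 - t + t * ?\<alpha> = a" using tt by (simp add: algebra_simps)
  have y: "t * ?\<beta> = c * (1 - a)" unfolding tt[symmetric] by (simp add: mult_ac)
  have "?\<beta> * (1 - t) = c * (1 - a * b - t * (1 - a * b))" by (simp add: algebra_simps)
  then have q: "?\<beta> * (1 - t) / a = c * (1 - b)" unfolding tt using a by (simp add: field_simps)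
  have p: "?\<alpha> / a = b" using a by simp
  show ?thesis
    using ear_cut_split[of ?\<alpha> ?\<beta> t] a b \<beta> sum t unfolding x y q p by simp
qed

text \<open>The matrices of \<open>ear_cut_line_mult\<close> share the eigenvectors
  \<open>(1, -c)\<close> and \<open>(0, 1)\<close>, with eigenvalues \<open>a\<close> and 1.
  Together with the determinant factor \<open>a\<close>, the four products of eigenvectors carry the
  weights \<open>a ^ 3\<close>, \<open>a ^ 2\<close>, \<open>a ^ 2\<close> and \<open>a\<close>, and
  \<open>twisted_cocycle\<close> solves for each coefficient.\<close>

lemma ear_cut_line:
  assumes c: "c < 0 \<or> c > 1"
  shows "\<exists>\<kappa> \<eta> \<eta>' \<theta>. \<forall>a. a > 0 \<and> (1 - a) * c > 0 \<longrightarrow>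
    ear_cut a (c * (1 - a)) $ 1 $ 1 = \<kappa> * (a ^ 3 - 1) \<and>
    ear_cut a (c * (1 - a)) $ 1 $ 2 = - c * \<kappa> * (a ^ 3 - 1) + \<eta> * (a ^ 2 - 1) \<and>
    ear_cut a (c * (1 - a)) $ 2 $ 1 = - c * \<kappa> * (a ^ 3 - 1) + \<eta>' * (a ^ 2 - 1) \<and>
    ear_cut a (c * (1 - a)) $ 2 $ 2 = c ^ 2 * \<kappa> * (a ^ 3 - 1) - c * (\<eta> + \<eta>') * (a ^ 2 - 1) + \<theta> * (a - 1)"
proof -
  define F where "F i j a = ear_cut a (c * (1 - a)) $ i $ j" for i j a
  define J where "J = {a. a > 0 \<and> (1 - a) * c > 0}"
  have F11: "F 1 1 (a * b) = F 1 1 a + a ^ 3 * F 1 1 b"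
    and F12: "F 1 2 (a * b) = F 1 2 a + a ^ 2 * (c * (1 - a) * F 1 1 b + F 1 2 b)"
    and F21: "F 2 1 (a * b) = F 2 1 a + a ^ 2 * (c * (1 - a) * F 1 1 b + F 2 1 b)"
    and F22: "F 2 2 (a * b) = F 2 2 a + a * ((c * (1 - a)) ^ 2 * F 1 1 b
      + c * (1 - a) * (F 1 2 b + F 2 1 b) + F 2 2 b)"
    if "a \<in> J" "b \<in> J" for a b
    using ear_cut_line_mult[OF c, of a b] that unfolding J_def F_def
    by (simp_all add: conjugate_2 algebra_simps power2_eq_square power3_eq_cube)
  obtain a0 where a0: "a0 \<in> J" "a0 > 0" "a0 \<noteq> 1"
    using c by (elim disjE) (auto simp: J_def intro: that[of 2] that[of "1/2"])
  have ne: "a0 ^ 3 \<noteq> 1" "a0 ^ 2 \<noteq> 1" "a0 ^ 1 \<noteq> 1"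
    using a0 power_eq_1_iff[of a0 3] power_eq_1_iff[of a0 2] by auto
  obtain \<kappa> where \<kappa>: "\<And>a. a \<in> J \<Longrightarrow> F 1 1 a = \<kappa> * (a ^ 3 - 1)"
    using twisted_cocycle[of J "F 1 1" 3, OF F11 a0(1) ne(1)] by blast
  obtain \<eta> where \<eta>: "\<And>a. a \<in> J \<Longrightarrow> F 1 2 a + c * \<kappa> * (a ^ 3 - 1) = \<eta> * (a ^ 2 - 1)"
  proof -
    let ?h = "\<lambda>a. F 1 2 a + c * \<kappa> * (a ^ 3 - 1)"
    have "?h (a * b) = ?h a + a ^ 2 * ?h b" if "a \<in> J" "b \<in> J" for a b
      unfolding F12[OF that] \<kappa>[OF that(2)]
      by (simp add: algebra_simps power2_eq_square power3_eq_cube)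
    from twisted_cocycle[of J ?h 2, OF this a0(1) ne(2)] show thesis using that by blast
  qed
  obtain \<eta>' where \<eta>': "\<And>a. a \<in> J \<Longrightarrow> F 2 1 a + c * \<kappa> * (a ^ 3 - 1) = \<eta>' * (a ^ 2 - 1)"
  proof -
    let ?h = "\<lambda>a. F 2 1 a + c * \<kappa> * (a ^ 3 - 1)"
    have "?h (a * b) = ?h a + a ^ 2 * ?h b" if "a \<in> J" "b \<in> J" for a b
      unfolding F21[OF that] \<kappa>[OF that(2)]
      by (simp add: algebra_simps power2_eq_square power3_eq_cube)
    from twisted_cocycle[of J ?h 2, OF this a0(1) ne(2)] show thesis using that by blast
  qed
  have 12: "F 1 2 a = \<eta> * (a ^ 2 - 1) - c * \<kappa> * (a ^ 3 - 1)" if "a \<in> J" for a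
    using \<eta>[OF that] by simp
  have 21: "F 2 1 a = \<eta>' * (a ^ 2 - 1) - c * \<kappa> * (a ^ 3 - 1)" if "a \<in> J" for a
    using \<eta>'[OF that] by simp
  \<comment> \<open>The coefficient of the product of \<open>(0, 1)\<close> with itself.\<close>
  let ?h = "\<lambda>a. F 2 2 a - c ^ 2 * \<kappa> * (a ^ 3 - 1) + c * (\<eta> + \<eta>') * (a ^ 2 - 1)"
  have "?h (a * b) = ?h a + a ^ 1 * ?h b" if "a \<in> J" "b \<in> J" for a b
    unfolding F22[OF that] \<kappa>[OF that(2)] 12[OF that(2)] 21[OF that(2)]
    by (simp add: algebra_simps power2_eq_square power3_eq_cube)
  from twisted_cocycle[of J ?h 1, OF this a0(1) ne(3)]
  obtain \<theta> where \<theta>: "\<And>a. a \<in> J \<Longrightarrow> ?h a = \<theta> * (a - 1)" by auto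
  have 22: "F 2 2 a = c ^ 2 * \<kappa> * (a ^ 3 - 1) - c * (\<eta> + \<eta>') * (a ^ 2 - 1) + \<theta> * (a - 1)" if "a \<in> J" for a
    using \<theta>[OF that] by simp
  show ?thesis
    using \<kappa> 12 21 22 unfolding F_def J_def
    by (intro exI[of _ \<kappa>] exI[of _ \<eta>] exI[of _ \<eta>'] exI[of _ \<theta>]) simp
qed

text \<open>An apex with \<open>a \<noteq> 1\<close> lies on the line with
  \<open>c = b / (1 - a)\<close>; if also \<open>b \<noteq> 1\<close>, swapping the coordinates
  moves it to the line with \<open>d = a / (1 - b)\<close>. \<open>T\<close> and \<open>S\<close>
  are the resulting relations between the constants of the two lines.\<close>

lemma ear_cut_eq_0_aux:
  assumes zero: "ear_cut (1/2) 1 $ 1 $ 1 = 0" and ab: "a > 0" "b > 0" "a + b > 1" "a \<noteq> 1"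
  shows "ear_cut a b = 0"
proof -
  obtain \<kappa> \<eta> \<eta>' \<theta> where line: "\<And>c a. c < 0 \<or> c > 1 \<Longrightarrow> a > 0 \<and> (1 - a) * c > 0 \<longrightarrow>
    ear_cut a (c * (1 - a)) $ 1 $ 1 = \<kappa> c * (a ^ 3 - 1) \<and>
    ear_cut a (c * (1 - a)) $ 1 $ 2 = - c * \<kappa> c * (a ^ 3 - 1) + \<eta> c * (a ^ 2 - 1) \<and>
    ear_cut a (c * (1 - a)) $ 2 $ 1 = - c * \<kappa> c * (a ^ 3 - 1) + \<eta>' c * (a ^ 2 - 1) \<and>
    ear_cut a (c * (1 - a)) $ 2 $ 2 = c ^ 2 * \<kappa> c * (a ^ 3 - 1) - c * (\<eta> c + \<eta>' c) * (a ^ 2 - 1) + \<theta> c * (a - 1)"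
    using ear_cut_line by metis
  have node: "c < 0 \<or> c > 1" "(1 - a) * c > 0" "b = c * (1 - a)"
    if "a > 0" "b > 0" "a + b > 1" "a \<noteq> 1" "c = b / (1 - a)" for a b c :: real
  proof -
    show b: "b = c * (1 - a)" using that by simp
    show "c < 0 \<or> c > 1"
      using that by (cases "a < 1") (auto simp: divide_less_0_iff less_divide_eq)
    show "(1 - a) * c > 0" using b that(2) by (simp add: mult.commute)
  qed
  have ear_cut: "ear_cut a b $ 1 $ 1 = \<kappa> c * (a ^ 3 - 1)"
    "ear_cut a b $ 1 $ 2 = - c * \<kappa> c * (a ^ 3 - 1) + \<eta> c * (a ^ 2 - 1)"
    "ear_cut a b $ 2 $ 1 = - c * \<kappa> c * (a ^ 3 - 1) + \<eta>' c * (a ^ 2 - 1)"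
    "ear_cut a b $ 2 $ 2 = c ^ 2 * \<kappa> c * (a ^ 3 - 1) - c * (\<eta> c + \<eta>' c) * (a ^ 2 - 1) + \<theta> c * (a - 1)"
    if "a > 0" "b > 0" "a + b > 1" "a \<noteq> 1" "c = b / (1 - a)" for a b c
    using line[OF node(1)[OF that], of a] node[OF that] that(1) by auto
  have T: "c ^ 2 * \<kappa> c * (a ^ 3 - 1) - c * (\<eta> c + \<eta>' c) * (a ^ 2 - 1) + \<theta> c * (a - 1)
      = \<kappa> d * (b ^ 3 - 1)"
    and S: "- c * \<kappa> c * (a ^ 3 - 1) + \<eta> c * (a ^ 2 - 1) = - d * \<kappa> d * (b ^ 3 - 1) + \<eta>' d * (b ^ 2 - 1)"
    if "a > 0" "b > 0" "a + b > 1" "a \<noteq> 1" "b \<noteq> 1" "c = b / (1 - a)" "d = a / (1 - b)" for a b c d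
    using ear_cut_swap[OF that(1-3)] ear_cut[of a b c] ear_cut[of b a d] that by (simp_all add: add.commute)
  \<comment> \<open>The swap relations between the lines \<open>c = 2\<close> and \<open>c = 3\<close> form a linear system whose
    solution space is one-dimensional, hence is killed by \<open>\<kappa> 2 = 0\<close>.\<close>
  have \<kappa>2: "\<kappa> 2 = 0" using ear_cut(1)[of "1/2" 1 2] zero by (simp add: power3_eq_cube)
  note num = power2_eq_square power3_eq_cube
  have s2: "\<eta> 2 = \<eta>' 2" using S[of "2/3" "2/3" 2 2] by (simp add: num)
  have s3: "\<eta> 3 = \<eta>' 3" using S[of "3/4" "3/4" 3 3] by (simp add: num)
  have n2: "\<eta> 2 = 0 \<and> \<theta> 2 = 0"
    using T[of "2/3" "2/3" 2 2] T[of "3/4" "3/4" 3 3] T[of "3/5" "4/5" 2 3] T[of "4/5" "3/5" 3 2]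
      S[of "3/5" "4/5" 2 3] \<kappa>2 s2 s3
    by (simp add: num)
  define c where "c = b / (1 - a)"
  have c: "c < 0 \<or> c > 1" using node[OF ab c_def] by simp
  \<comment> \<open>\<open>(u, w)\<close> is the apex lying on the line with parameter \<open>2\<close> whose mirror image lies on the
    line with parameter \<open>c\<close>.\<close>
  define u where "u = c / (2 * c - 1)"
  define w where "w = 2 * (c - 1) / (2 * c - 1)"
  have uw: "u > 0" "w > 0" "u + w > 1" "u \<noteq> 1" "w \<noteq> 1" "2 = w / (1 - u)" "c = u / (1 - w)"
    using c by (auto simp: u_def w_def divide_simps split: if_splits)
  have w: "w ^ 3 - 1 \<noteq> 0" "w ^ 2 - 1 \<noteq> 0" "w - 1 \<noteq> 0"
    using uw power_eq_1_iff[of w 3] power_eq_1_iff[of w 2] by auto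
  have \<kappa>c: "\<kappa> c = 0" using T[of u w 2 c] uw n2 s2 \<kappa>2 w by simp
  have \<eta>'c: "\<eta>' c = 0" using S[of u w 2 c] uw n2 s2 \<kappa>2 \<kappa>c w by simp
  have \<eta>c: "\<eta> c = 0" using S[of w u c 2] uw n2 s2 \<kappa>2 \<kappa>c w by simp
  have \<theta>c: "\<theta> c = 0" using T[of w u c 2] uw \<kappa>2 \<kappa>c \<eta>c \<eta>'c w by simp
  show ?thesis
    using ear_cut[OF ab c_def] \<kappa>c \<eta>c \<eta>'c \<theta>c by (simp add: vec_eq_iff forall_2)
qed

text \<open>Apexes with \<open>a = 1\<close> are reached by the swap, except \<open>(1, 1)\<close>,
  which is split at \<open>t = 1/2\<close> into two triangles with apex coordinates
  \<open>(1, 1/2)\<close>.\<close>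

lemma ear_cut_eq_0:
  assumes zero: "ear_cut (1/2) 1 $ 1 $ 1 = 0" and ab: "a > 0" "b > 0" "a + b > 1"
  shows "ear_cut a b = 0"
proof -
  note aux = ear_cut_eq_0_aux[OF zero]
  have 1: "ear_cut 1 b = 0" if "b > 0" "b \<noteq> 1" for b
    using aux[of b 1] ear_cut_swap[of b 1] that by (simp add: vec_eq_iff forall_2)
  have "ear_cut 1 1 = 0"
    using ear_cut_split[of 1 1 "1/2"] 1[of "1/2"] by (simp add: vec_eq_iff conjugate_2)
  then show ?thesis using aux[OF ab] 1[OF ab(2)] by (cases "a = 1"; cases "b = 1") auto
qed

end

section \<open>Vanishing on triangles\<close>

text \<open>Just to the right of \<open>x\<close>, two affine functions compare by their values at
  \<open>x\<close> and, in case of a tie, by slope. This later selects the edge that all nearby rays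
  hit first.\<close>

lemma affine_dominant_right:
  fixes u v :: "'a \<Rightarrow> real"
  assumes "finite A" "A \<noteq> {}"
  shows "\<exists>i\<in>A. \<exists>d>0. \<forall>n\<in>A. \<forall>\<tau>. x \<le> \<tau> \<and> \<tau> < x + d \<longrightarrow> u n + v n * \<tau> \<le> u i + v i * \<tau>"
  using assms
proof (induction A rule: finite_ne_induct)
  case (singleton a)
  then show ?case by (auto intro: exI[of _ 1])
next
  case (insert m A)
  then obtain i d where i: "i \<in> A" "d > 0"
    "\<And>n \<tau>. n \<in> A \<Longrightarrow> x \<le> \<tau> \<Longrightarrow> \<tau> < x + d \<Longrightarrow> u n + v n * \<tau> \<le> u i + v i * \<tau>"
    by blast
  define f where "f \<tau> = (u i - u m) + (v i - v m) * \<tau>" for \<tau>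
  have f: "f \<tau> = f x + (v i - v m) * (\<tau> - x)" for \<tau> by (simp add: f_def algebra_simps)
  have cont: "isCont f x" unfolding f_def by (intro continuous_intros)
  consider "f x > 0" | "f x < 0" | "f x = 0" "v i \<ge> v m" | "f x = 0" "v i \<le> v m" by linarith
  then have "\<exists>e>0. (\<forall>\<tau>. x \<le> \<tau> \<and> \<tau> < x + e \<longrightarrow> f \<tau> \<ge> 0) \<or> (\<forall>\<tau>. x \<le> \<tau> \<and> \<tau> < x + e \<longrightarrow> f \<tau> \<le> 0)"
  proof cases
    case 1
    then obtain e where e: "e > 0" "\<And>\<tau>. dist \<tau> x < e \<Longrightarrow> dist (f \<tau>) (f x) < f x"
      using cont unfolding continuous_at_eps_delta by blast
    have "f \<tau> \<ge> 0" if "x \<le> \<tau>" "\<tau> < x + e" for \<tau>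
      using e(2)[of \<tau>] that by (simp add: dist_real_def abs_less_iff)
    then show ?thesis using e(1) by (intro exI[of _ e]) auto
  next
    case 2
    then obtain e where e: "e > 0" "\<And>\<tau>. dist \<tau> x < e \<Longrightarrow> dist (f \<tau>) (f x) < - f x"
      using cont unfolding continuous_at_eps_delta by (meson neg_0_less_iff_less)
    have "f \<tau> \<le> 0" if "x \<le> \<tau>" "\<tau> < x + e" for \<tau>
      using e(2)[of \<tau>] that by (simp add: dist_real_def abs_less_iff)
    then show ?thesis using e(1) by (intro exI[of _ e]) auto
  next
    case 3
    then have "f \<tau> \<ge> 0" if "x \<le> \<tau>" for \<tau> using f[of \<tau>] that by simp
    then show ?thesis by (intro exI[of _ 1]) auto
  next
    case 4
    then have "f \<tau> \<le> 0" if "x \<le> \<tau>" for \<tau>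
      using f[of \<tau>] that by (simp add: mult_nonpos_nonneg)
    then show ?thesis by (intro exI[of _ 1]) auto
  qed
  then obtain e where e: "e > 0"
    "(\<forall>\<tau>. x \<le> \<tau> \<and> \<tau> < x + e \<longrightarrow> f \<tau> \<ge> 0) \<or> (\<forall>\<tau>. x \<le> \<tau> \<and> \<tau> < x + e \<longrightarrow> f \<tau> \<le> 0)" by blast
  from e(2) show ?case
  proof
    assume "\<forall>\<tau>. x \<le> \<tau> \<and> \<tau> < x + e \<longrightarrow> f \<tau> \<ge> 0"
    then show ?thesis using i e(1)
      by (intro bexI[of _ i] exI[of _ "min d e"]) (auto simp: f_def algebra_simps)
  next
    assume *: "\<forall>\<tau>. x \<le> \<tau> \<and> \<tau> < x + e \<longrightarrow> f \<tau> \<le> 0"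
    have "u n + v n * \<tau> \<le> u m + v m * \<tau>" if "n \<in> A" "x \<le> \<tau>" "\<tau> < x + min d e" for n \<tau>
      using i(3)[of n \<tau>] * that by (force simp: f_def algebra_simps)
    then show ?thesis using i(2) e(1)
      by (intro bexI[of _ m] exI[of _ "min d e"]) auto
  qed
qed

lemma affine_dominant_left:
  fixes u v :: "'a \<Rightarrow> real"
  assumes "finite A" "A \<noteq> {}"
  shows "\<exists>i\<in>A. \<exists>d>0. \<forall>n\<in>A. \<forall>\<tau>. x - d < \<tau> \<and> \<tau> \<le> x \<longrightarrow> u n + v n * \<tau> \<le> u i + v i * \<tau>"
proof -
  obtain i d where i: "i \<in> A" "d > 0"
    "\<And>n \<tau>. n \<in> A \<Longrightarrow> - x \<le> \<tau> \<Longrightarrow> \<tau> < - x + d \<Longrightarrow> u n + - v n * \<tau> \<le> u i + - v i * \<tau>"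
    using affine_dominant_right[OF assms, of "- x" u "\<lambda>n. - v n"] by blast
  have "u n + v n * \<tau> \<le> u i + v i * \<tau>" if "n \<in> A" "x - d < \<tau>" "\<tau> \<le> x" for n \<tau>
    using i(3)[of n "- \<tau>"] that by simp
  then show ?thesis using i by blast
qed

text \<open>Some defining constraint is tight at \<open>a\<close>: if all were strict, they would
  give an open neighbourhood inside \<open>K\<close>.\<close>

lemma exists_supporting_halfplane:
  assumes "K \<in> polygons_o" "a \<in> K" "a \<notin> interior K"
  shows "\<exists>g. K \<subseteq> halfplane g \<and> g \<bullet> a = 1"
proof -
  obtain N where N: "finite N" "K = \<Inter>(halfplane ` N)" by (rule polygons_o_halfplanes[OF assms(1)])
  have "\<exists>n\<in>N. \<not> n \<bullet> a < 1"
  proof (rule ccontr)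
    assume "\<not> ?thesis"
    then have "a \<in> (\<Inter>n\<in>N. {x. n \<bullet> x < 1})" by auto
    moreover have "open (\<Inter>n\<in>N. {x. n \<bullet> x < 1})"
      using N(1) by (auto intro: open_halfspace_lt)
    moreover have "(\<Inter>n\<in>N. {x. n \<bullet> x < 1}) \<subseteq> K"
      unfolding N(2) halfplane_def by (force intro: less_imp_le)
    ultimately show False using assms(3) interior_maximal by blast
  qed
  then obtain n where "n \<in> N" "\<not> n \<bullet> a < 1" by blast
  moreover from this have "n \<bullet> a \<le> 1" using assms(2) N(2) by (auto simp: halfplane_def)
  ultimately show ?thesis using N(2) by (intro exI[of _ n]) auto
qed

section \<open>Rotating the cutting line about a boundary point\<close>

locale ear_null_valuation = covariant_valuation +
  assumes ear_cut_null: "\<And>a b. a > 0 \<Longrightarrow> b > 0 \<Longrightarrow> a + b > 1 \<Longrightarrow> ear_cut a b = 0"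
begin

text \<open>The base runs from \<open>(1, 0)\<close> to the point \<open>(1 - t * yb, yb)\<close>
  where the line of \<open>t\<close> meets the edge \<open>(p, r)\<close>. These points are the
  columns of \<open>?\<phi>\<close>, and \<open>(\<alpha>, \<beta>)\<close> are the coordinates in
  that basis of the apex, where the line of \<open>s\<close> meets the edge.\<close>

lemma cut_triangle:
  assumes K: "K \<in> polygons_o" and st: "s < t" and p: "p < 1" and pos: "r - p * s > 0" "r - p * t > 0"
    and diff: "K - halfplane (vector [1, t]) =
      halfplane (vector [1, s]) \<inter> halfplane (vector [p, r]) - halfplane (vector [1, t])"
  shows "cut (vector [1, t]) K = 0"
proof -
  define yb where "yb = (1 - p) / (r - p * t)"
  define \<alpha> where "\<alpha> = (t - s) / (r - p * s)"
  define \<beta> where "\<beta> = (r - p * t) / (r - p * s)"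
  have yb: "yb > 0" using p pos by (simp add: yb_def)
  have \<alpha>\<beta>: "\<alpha> > 0" "\<beta> > 0" using st pos by (simp_all add: \<alpha>_def \<beta>_def)
  have 0: "1 - \<beta> = p * \<alpha>" using pos by (simp add: \<alpha>_def \<beta>_def field_simps)
  have 1: "(1 - \<beta>) / \<alpha> = p" using 0 \<alpha>\<beta> by simp
  have "p * \<alpha> < 1 * \<alpha>" using p \<alpha>\<beta> by (intro mult_strict_right_mono) auto
  then have sum: "\<alpha> + \<beta> > 1" using 0 by simp
  have 2: "(1 - \<alpha>) / \<beta> = 1 - t * yb + s * yb"
    using pos by (simp add: \<alpha>_def \<beta>_def yb_def divide_simps) (simp add: algebra_simps)
  have 3: "p * (1 - t * yb) + r * yb = 1"
    using pos by (simp add: yb_def divide_simps) (simp add: algebra_simps)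
  let ?\<phi> = "vector [vector [1, 1 - t * yb], vector [0, yb]] :: real^2^2"
  have inv: "invertible ?\<phi>" using yb by (simp add: invertible_det_nz det_2)
  have mem: "?\<phi> *v z \<in> halfplane (vector [a, b]) \<longleftrightarrow> a * z $ 1 + (a * (1 - t * yb) + b * yb) * z $ 2 \<le> 1" for z a b
    by (simp add: halfplane_vector matrix_vector_mult_2 algebra_simps)
  have H: "(*v) ?\<phi> -` halfplane (vector [1, t]) = halfplane 1"
    by (auto simp: mem halfplane_1)
  have E: "(*v) ?\<phi> -` (halfplane (vector [1, s]) \<inter> halfplane (vector [p, r])) = ear \<alpha> \<beta>"
    unfolding ear_def 1 2 set_eq_iff vimage_eq Int_iff mem 3 by (simp add: halfplane_vector)
  have "(*v) ?\<phi> -` K - halfplane 1 = ear \<alpha> \<beta> - halfplane 1"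
    using arg_cong[OF diff, of "vimage ((*v) ?\<phi>)"] by (simp add: vimage_Diff H E del: vimage_Int)
  then have "cut 1 ((*v) ?\<phi> -` K) = 0"
    using cut_eq_ear_cut[OF \<alpha>\<beta> sum polygons_o_vimage[OF K inv]] ear_cut_null[OF \<alpha>\<beta> sum] by simp
  then show ?thesis
    using cut_vimage[OF K inv H] by (simp add: vec_eq_iff conjugate_2)
qed

text \<open>The cutting lines rotate about \<open>(1, 0)\<close>. Between two directions for which the rays leave
  \<open>K\<close> through the same edge, a triangle is cut off; \<open>1 / g n \<tau>\<close> is the distance (in the second
  coordinate) at which the ray with parameter \<open>\<tau>\<close> crosses the edge \<open>n\<close>.\<close>
lemma cut_fan_tight:
  assumes K: "K \<in> polygons_o" "vector [1, 0] \<in> K" "K \<subseteq> halfplane (vector [1, t0])"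
    and N: "finite N" "K = \<Inter>(halfplane ` N)"
    and tight: "\<And>n. n \<in> N \<Longrightarrow> n $ 1 = 1 \<Longrightarrow> n $ 2 \<le> t0"
    and T: "t0 \<le> T"
  shows "cut (vector [1, T]) K = 0"
proof -
  let ?L = "\<lambda>t. halfplane (vector [1, t])"
  define A where "A = {n \<in> N. n $ 1 < 1}"
  \<comment> \<open>The reciprocal distance is affine in \<open>\<tau>\<close> and remains defined,
    with value at most 0, when the ray never meets the edge.\<close>
  define g where "g n \<tau> = n $ 2 / (1 - n $ 1) + (- n $ 1 / (1 - n $ 1)) * \<tau>" for n :: "real^2" and \<tau>
  have finA: "finite A" using N by (simp add: A_def)
  have le1: "n $ 1 \<le> 1" if "n \<in> N" for n
    using K(2) that N(2) by (auto simp: mem_halfplane)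
  have g_eq: "g n \<tau> = (n $ 2 - n $ 1 * \<tau>) / (1 - n $ 1)" for n \<tau>
    by (simp add: g_def diff_divide_distrib)
  have g: "n $ 1 * (1 - \<tau> * y) + n $ 2 * y \<le> 1 \<longleftrightarrow> g n \<tau> * y \<le> 1" if "n \<in> A" for n \<tau> y
  proof -
    have "g n \<tau> * y \<le> 1 \<longleftrightarrow> (n $ 2 - n $ 1 * \<tau>) * y \<le> 1 - n $ 1"
      using that by (simp add: g_eq A_def pos_divide_le_eq)
    then show ?thesis by (simp add: algebra_simps)
  qed
  \<comment> \<open>Otherwise the whole ray would stay in the bounded set \<open>K\<close>.\<close>
  have posg: "\<exists>n\<in>A. g n \<tau> > 0" if \<tau>: "t0 \<le> \<tau>" for \<tau>
  proof (rule ccontr)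
    assume "\<not> ?thesis"
    then have neg: "g n \<tau> \<le> 0" if "n \<in> A" for n using that by force
    have ray: "vector [1 - \<tau> * y, y] \<in> K" if "y \<ge> 0" for y
      unfolding N(2)
    proof safe
      fix n assume n: "n \<in> N"
      show "vector [1 - \<tau> * y, y] \<in> halfplane n"
      proof (cases "n \<in> A")
        case True
        have "g n \<tau> * y \<le> 0" using neg[OF True] that by (simp add: mult_nonpos_nonneg)
        then show ?thesis using g[OF True, of \<tau> y] by (simp add: mem_halfplane)
      next
        case False
        then have "n $ 1 = 1" using le1[OF n] n by (auto simp: A_def)
        moreover from this have "n $ 2 * y \<le> \<tau> * y"
          using tight[OF n] \<tau> that by (intro mult_right_mono) auto
        ultimately show ?thesis by (simp add: mem_halfplane)
      qed
    qed
    obtain B where B: "\<And>x. x \<in> K \<Longrightarrow> norm x \<le> B"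
      using polygons_oD(6)[OF K(1)] by (auto simp: bounded_iff)
    have "norm (vector [1 - \<tau> * (\<bar>B\<bar> + 1), \<bar>B\<bar> + 1] :: real^2) \<le> B"
      by (intro B ray) simp
    moreover have "\<bar>(vector [1 - \<tau> * (\<bar>B\<bar> + 1), \<bar>B\<bar> + 1] :: real^2) $ 2\<bar>
        \<le> norm (vector [1 - \<tau> * (\<bar>B\<bar> + 1), \<bar>B\<bar> + 1] :: real^2)"
      by (rule component_le_norm_cart)
    ultimately show False by simp
  qed
  have A_ne: "A \<noteq> {}" using posg[of t0] by auto
  have mono: "K \<inter> ?L t \<subseteq> ?L s" if "t0 \<le> s" "s \<le> t" for s t
  proof
    fix z assume z: "z \<in> K \<inter> ?L t"
    then have "z $ 1 + t * z $ 2 \<le> 1" "z $ 1 + t0 * z $ 2 \<le> 1"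
      using K(3) by (auto simp: halfplane_vector)
    moreover have "s * z $ 2 \<le> t * z $ 2 \<or> s * z $ 2 \<le> t0 * z $ 2"
      using that by (cases "z $ 2 \<ge> 0") (auto intro: mult_right_mono mult_right_mono_neg)
    ultimately show "z \<in> ?L s" by (auto simp: halfplane_vector)
  qed
  \<comment> \<open>Edge \<open>i\<close> has the largest reciprocal distance, so between the rays
    \<open>s\<close> and \<open>t\<close> it is hit first and alone bounds the piece.\<close>
  have step: "\<nu> (K \<inter> ?L s) = \<nu> (K \<inter> ?L t)"
    if s: "t0 \<le> s" and st: "s < t" and i: "i \<in> A"
      and dom: "\<And>n \<tau>. n \<in> A \<Longrightarrow> s \<le> \<tau> \<Longrightarrow> \<tau> \<le> t \<Longrightarrow> g n \<tau> \<le> g i \<tau>" for s t i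
  proof -
    have i1: "i $ 1 < 1" using i by (simp add: A_def)
    have pos: "g i \<tau> > 0" if "s \<le> \<tau>" "\<tau> \<le> t" for \<tau>
      using posg[of \<tau>] dom[of _ \<tau>] s that by (meson less_le_trans order_trans)
    have pos': "i $ 2 - i $ 1 * \<tau> > 0" if "s \<le> \<tau>" "\<tau> \<le> t" for \<tau>
      using pos[OF that] i1 by (simp add: g_eq zero_less_divide_iff)
    have "K \<inter> ?L s - ?L t = ?L s \<inter> halfplane (vector [i $ 1, i $ 2]) - ?L t"
    proof safe
      fix z assume "z \<in> K"
      then show "z \<in> halfplane (vector [i $ 1, i $ 2])"
        using i N(2) by (auto simp: A_def halfplane_vector mem_halfplane)
    next
      fix z assume z: "z \<in> ?L s" "z \<notin> ?L t" "z \<in> halfplane (vector [i $ 1, i $ 2])"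
      then have z': "z $ 1 + s * z $ 2 \<le> 1" "z $ 1 + t * z $ 2 > 1" "i $ 1 * z $ 1 + i $ 2 * z $ 2 \<le> 1"
        by (auto simp: halfplane_vector)
      then have "(t - s) * z $ 2 > 0" by (simp add: algebra_simps)
      then have y: "z $ 2 > 0" using st by (simp add: zero_less_mult_iff)
      \<comment> \<open>The parameter of the ray from \<open>(1, 0)\<close> through
        \<open>z\<close>.\<close>
      define \<tau> where "\<tau> = (1 - z $ 1) / z $ 2"
      have z1: "z $ 1 = 1 - \<tau> * z $ 2" using y by (simp add: \<tau>_def)
      have \<tau>: "s \<le> \<tau>" "\<tau> \<le> t" using y z' by (auto simp: \<tau>_def field_simps)
      show "z \<in> K"
        unfolding N(2)
      proof safe
        fix n assume n: "n \<in> N"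
        show "z \<in> halfplane n"
        proof (cases "n \<in> A")
          case True
          have "g n \<tau> * z $ 2 \<le> g i \<tau> * z $ 2"
            using dom[OF True \<tau>] y by (intro mult_right_mono) auto
          also have "\<dots> \<le> 1" using g[OF i] z'(3) unfolding z1 by simp
          finally show ?thesis using g[OF True, of \<tau> "z $ 2"] unfolding mem_halfplane z1 by simp
        next
          case False
          then have "n $ 1 = 1" using le1[OF n] n by (auto simp: A_def)
          moreover from this have "n $ 2 * z $ 2 \<le> s * z $ 2"
            using tight[OF n] s y by (intro mult_right_mono) auto
          ultimately show ?thesis using z' by (simp add: mem_halfplane)
        qed
      qed
    qed
    then have "cut (vector [1, t]) (K \<inter> ?L s) = 0"
      using st i1 pos'[of s] pos'[of t]
      by (intro cut_triangle[where s = s and p = "i $ 1" and r = "i $ 2"] polygons_o_Int_halfplane K) auto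
    moreover have "K \<inter> ?L s \<inter> ?L t = K \<inter> ?L t" using mono[of s t] s st by auto
    ultimately show ?thesis by (simp add: cut_def)
  qed
  \<comment> \<open>Constancy near each parameter spreads over the interval by
    \<open>Bolzano\<close>; the guard \<open>t0 \<le> a\<close> covers small intervals starting left
    of \<open>t0\<close>.\<close>
  define Q where "Q a b \<longleftrightarrow> (t0 \<le> a \<longrightarrow> \<nu> (K \<inter> ?L a) = \<nu> (K \<inter> ?L b))" for a b
  have "Q t0 T"
    using T
  proof (induction rule: Bolzano)
    case (trans a b c)
    then show ?case by (auto simp: Q_def)
  next
    case (local x)
    obtain i d where i: "i \<in> A" "d > 0"
      "\<And>n \<tau>. n \<in> A \<Longrightarrow> x \<le> \<tau> \<Longrightarrow> \<tau> < x + d \<Longrightarrow> g n \<tau> \<le> g i \<tau>"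
      using affine_dominant_right[OF finA A_ne, of x "\<lambda>n. n $ 2 / (1 - n $ 1)"
          "\<lambda>n. - n $ 1 / (1 - n $ 1)", folded g_def] by blast
    obtain j e where j: "j \<in> A" "e > 0"
      "\<And>n \<tau>. n \<in> A \<Longrightarrow> x - e < \<tau> \<Longrightarrow> \<tau> \<le> x \<Longrightarrow> g n \<tau> \<le> g j \<tau>"
      using affine_dominant_left[OF finA A_ne, of x "\<lambda>n. n $ 2 / (1 - n $ 1)"
          "\<lambda>n. - n $ 1 / (1 - n $ 1)", folded g_def] by blast
    have "\<nu> (K \<inter> ?L a) = \<nu> (K \<inter> ?L b)"
      if ab: "a \<le> x" "x \<le> b" "b - a < min d e" "t0 \<le> a" for a b
    proof -
      have "\<nu> (K \<inter> ?L a) = \<nu> (K \<inter> ?L x)"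
        using ab j by (cases "a = x") (auto intro!: step[of a x j])
      also have "\<dots> = \<nu> (K \<inter> ?L b)"
        using ab i local by (cases "x = b") (auto intro!: step[of x b i])
      finally show ?thesis .
    qed
    then show ?case using i(2) j(2) by (intro exI[of _ "min d e"]) (auto simp: Q_def)
  qed
  moreover have "K \<inter> ?L t0 = K" using K(3) by auto
  ultimately show ?thesis by (simp add: cut_def Q_def)
qed

text \<open>Constraints through \<open>(1, 0)\<close> may be sharper than \<open>t0\<close>, so the
  rotation starts from the largest parameter \<open>t1\<close>. For \<open>T < t1\<close> nothing is
  cut off, since the constraint for \<open>T\<close> follows from those for \<open>t0\<close> and
  \<open>t1\<close>.\<close>

lemma cut_fan:
  assumes K: "K \<in> polygons_o" "vector [1, 0] \<in> K" "K \<subseteq> halfplane (vector [1, t0])"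
    and T: "t0 \<le> T"
  shows "cut (vector [1, T]) K = 0"
proof -
  obtain N where N: "finite N" "K = \<Inter>(halfplane ` N)" by (rule polygons_o_halfplanes[OF K(1)])
  define S where "S = insert t0 ((\<lambda>n. n $ 2) ` {n \<in> N. n $ 1 = 1})"
  define t1 where "t1 = Max S"
  have fin: "finite S" "S \<noteq> {}" using N by (auto simp: S_def)
  have t1: "t0 \<le> t1" "\<And>n. n \<in> N \<Longrightarrow> n $ 1 = 1 \<Longrightarrow> n $ 2 \<le> t1"
    unfolding t1_def using fin by (auto intro!: Max_ge simp: S_def)
  have "t1 \<in> S" unfolding t1_def by (rule Max_in[OF fin])
  then have sub: "K \<subseteq> halfplane (vector [1, t1])"
    using K(3) N(2) unfolding S_def by (fastforce simp: halfplane_vector mem_halfplane)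
  show ?thesis
  proof (cases "t1 \<le> T")
    case True
    show ?thesis by (rule cut_fan_tight[OF K(1,2) sub N t1(2) True])
  next
    case False
    have "K \<subseteq> halfplane (vector [1, T])"
    proof
      fix z assume "z \<in> K"
      then have "z $ 1 + t1 * z $ 2 \<le> 1" "z $ 1 + t0 * z $ 2 \<le> 1"
        using K(3) sub by (auto simp: halfplane_vector)
      moreover have "T * z $ 2 \<le> t1 * z $ 2 \<or> T * z $ 2 \<le> t0 * z $ 2"
        using T False by (cases "z $ 2 \<ge> 0") (auto intro: mult_right_mono mult_right_mono_neg)
      ultimately show "z \<in> halfplane (vector [1, T])" by (auto simp: halfplane_vector)
    qed
    then have "K \<inter> halfplane (vector [1, T]) = K" by auto
    then show ?thesis by (simp add: cut_def)
  qed
qed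

text \<open>Let \<open>a\<close> be an endpoint of the chord that the line cuts out of
  \<open>K\<close>. In the basis formed by \<open>a\<close> and the direction \<open>m\<close> of
  the line, a supporting line at \<open>a\<close> is rotated about \<open>(1, 0)\<close> into the
  cutting line.\<close>

lemma cut_eq_0:
  assumes K: "K \<in> polygons_o"
  shows "cut n K = 0"
proof (cases "K \<subseteq> halfplane n")
  case True
  then have "K \<inter> halfplane n = K" by auto
  then show ?thesis by (simp add: cut_def)
next
  case False
  then obtain x0 where x0: "x0 \<in> K" "n \<bullet> x0 > 1"
    by (metis halfplane_def mem_Collect_eq not_le subsetI)
  define m :: "real^2" where "m = vector [- n $ 2, n $ 1]"
  have nm: "n \<bullet> m = 0" by (simp add: m_def inner_vec_def sum_2)
  have m: "m \<bullet> m > 0"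
    using x0 by (auto simp: m_def inner_vec_def sum_2 add_pos_nonneg add_nonneg_pos
        sum_power2_gt_zero_iff simp flip: power2_eq_square)
  let ?C = "K \<inter> {x. n \<bullet> x = 1}"
  have comp: "compact ?C" using polygons_oD(5)[OF K] closed_hyperplane by (rule compact_Int_closed)
  have "(1 / (n \<bullet> x0)) *\<^sub>R x0 \<in> ?C"
  proof -
    have "(1 / (n \<bullet> x0)) *\<^sub>R x0 + (1 - 1 / (n \<bullet> x0)) *\<^sub>R 0 \<in> K"
      using polygons_oD[OF K] x0 by (intro convexD) auto
    then show ?thesis using x0 by simp
  qed
  then have ne: "?C \<noteq> {}" by blast
  have "continuous_on ?C (\<lambda>x. m \<bullet> x)" by (intro continuous_intros)
  from continuous_attains_sup[OF comp ne this]
  obtain a where a: "a \<in> ?C" "\<And>x. x \<in> ?C \<Longrightarrow> m \<bullet> x \<le> m \<bullet> a" by blast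
  \<comment> \<open>From an interior point one could move further along the chord in direction
    \<open>m\<close>.\<close>
  have "a \<notin> interior K"
  proof
    assume "a \<in> interior K"
    then obtain e where e: "e > 0" "cball a e \<subseteq> K" using mem_interior_cball by blast
    have "a + (e / norm m) *\<^sub>R m \<in> K" using e m by (intro subsetD[OF e(2)]) (auto simp: dist_norm)
    then have "a + (e / norm m) *\<^sub>R m \<in> ?C" using a(1) nm by (simp add: inner_add_right)
    from a(2)[OF this] show False
      using e m by (simp add: inner_add_right) (smt (verit) divide_pos_pos inner_gt_zero_iff mult_pos_pos zero_less_norm_iff)
  qed
  then obtain h where h: "K \<subseteq> halfplane h" "h \<bullet> a = 1"
    using exists_supporting_halfplane[OF K] a(1) by blast
  let ?\<phi> = "vector [vector [a $ 1, m $ 1], vector [a $ 2, m $ 2]] :: real^2^2"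
  have na: "n $ 1 * a $ 1 + n $ 2 * a $ 2 = 1" using a(1) by (simp add: inner_vec_def sum_2)
  have inv: "invertible ?\<phi>"
    using na by (simp add: invertible_det_nz det_2 m_def algebra_simps)
  have mem: "?\<phi> *v z \<in> halfplane k \<longleftrightarrow> (k \<bullet> a) * z $ 1 + (k \<bullet> m) * z $ 2 \<le> 1" for k z
    by (simp add: mem_halfplane matrix_vector_mult_2 inner_vec_def sum_2 algebra_simps)
  have H: "(*v) ?\<phi> -` halfplane n = halfplane (vector [1, 0])"
    using a(1) by (auto simp: mem nm halfplane_vector)
  let ?K = "(*v) ?\<phi> -` K"
  have K': "?K \<in> polygons_o" using polygons_o_vimage[OF K inv] .
  have e1: "vector [1, 0] \<in> ?K"
  proof -
    have "?\<phi> *v vector [1, 0] = a" by (simp add: vec_eq_iff forall_2 matrix_vector_mult_2)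
    then show ?thesis using a(1) by simp
  qed
  have sub: "?K \<subseteq> halfplane (vector [1, h \<bullet> m])"
    using h mem[of _ h] by (auto simp: halfplane_vector)
  have "cut (vector [1, 0]) ?K = 0"
  proof (cases "h \<bullet> m \<le> 0")
    case True
    then show ?thesis by (rule cut_fan[OF K' e1 sub])
  next
    case False
    \<comment> \<open>\<open>cut_fan\<close> rotates towards larger parameters; the reflection
      reverses the direction.\<close>
    let ?R = "vector [vector [1, 0], vector [0, - 1]] :: real^2^2"
    have invR: "invertible ?R" by (simp add: invertible_det_nz det_2)
    have HR: "(*v) ?R -` halfplane (vector [1, 0]) = halfplane (vector [1, 0])"
      by (auto simp: halfplane_vector matrix_vector_mult_2)
    have Re: "?R *v vector [1, 0] = vector [1, 0]" by (simp add: vec_eq_iff forall_2 matrix_vector_mult_2)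
    have "cut (vector [1, 0]) ((*v) ?R -` ?K) = 0"
    proof (rule cut_fan[OF polygons_o_vimage[OF K' invR]])
      show "vector [1, 0] \<in> (*v) ?R -` ?K" using e1 Re by simp
      show "(*v) ?R -` ?K \<subseteq> halfplane (vector [1, - (h \<bullet> m)])"
      proof
        fix z assume "z \<in> (*v) ?R -` ?K"
        then have "?R *v z \<in> halfplane (vector [1, h \<bullet> m])" using sub by blast
        then show "z \<in> halfplane (vector [1, - (h \<bullet> m)])"
          by (simp add: halfplane_vector matrix_vector_mult_2)
      qed
    qed (use False in simp)
    then show ?thesis using cut_vimage[OF K' invR HR] by (simp add: vec_eq_iff conjugate_2)
  qed
  then show ?thesis using cut_vimage[OF K inv H] by (simp add: vec_eq_iff conjugate_2)
qed

text \<open>Intersecting with halfplanes never changes \<open>\<nu>\<close>, so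
  \<open>\<nu> (K \<inter> L)\<close> equals both \<open>\<nu> K\<close> and \<open>\<nu> L\<close>.
  Thus \<open>\<nu>\<close> is constant, but doubling \<open>K\<close> multiplies it by 16.\<close>

lemma eq_0:
  assumes K: "K \<in> polygons_o"
  shows "\<nu> K = 0"
proof -
  have Int: "\<nu> (K \<inter> L) = \<nu> K" if K: "K \<in> polygons_o" and L: "L \<in> polygons_o" for K L
  proof -
    obtain N where N: "finite N" "L = \<Inter>(halfplane ` N)" by (rule polygons_o_halfplanes[OF L])
    have "K \<inter> \<Inter>(halfplane ` N) \<in> polygons_o \<and> \<nu> (K \<inter> \<Inter>(halfplane ` N)) = \<nu> K"
      using N(1)
    proof induction
      case (insert n N)
      let ?M = "K \<inter> \<Inter>(halfplane ` N)"
      have "K \<inter> \<Inter>(halfplane ` insert n N) = ?M \<inter> halfplane n" by auto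
      moreover have "\<nu> (?M \<inter> halfplane n) = \<nu> ?M"
        using cut_eq_0[of ?M n] insert.IH by (simp add: cut_def)
      ultimately show ?case using insert.IH polygons_o_Int_halfplane by simp
    qed (use K in simp)
    then show ?thesis using N(2) by simp
  qed
  let ?\<phi> = "mat 2 :: real^2^2"
  have inv: "invertible ?\<phi>" by (simp add: invertible_det_nz det_2 mat_def)
  have K2: "(*v) ?\<phi> ` K \<in> polygons_o" by (rule polygons_o_image[OF K inv])
  have "\<nu> K = \<nu> ((*v) ?\<phi> ` K)"
    using Int[OF K K2] Int[OF K2 K] by (simp add: Int_commute)
  also have "\<dots> = \<bar>det ?\<phi>\<bar> *\<^sub>R (?\<phi> ** \<nu> K ** transpose ?\<phi>)"
    by (rule covariant[OF K inv])
  finally show ?thesis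
    by (simp add: vec_eq_iff conjugate_2 mat_def det_2 forall_2)
qed

end

section \<open>The moment matrix\<close>

lemma absolutely_integrable_continuous_compact:
  fixes f :: "'a::euclidean_space \<Rightarrow> 'b::euclidean_space"
  assumes "compact S" "continuous_on S f"
  shows "f absolutely_integrable_on S"
proof -
  have "integrable lborel (\<lambda>x. indicator S x *\<^sub>R f x)"
    by (rule borel_integrable_compact[OF assms])
  then show ?thesis
    unfolding set_integrable_def by (subst integrable_completion) auto
qed

lemma integral_Un_Int:
  fixes f :: "'a::euclidean_space \<Rightarrow> real"
  assumes "f integrable_on K" "f integrable_on L" "f integrable_on (K \<union> L)" "f integrable_on (K \<inter> L)"
  shows "integral (K \<union> L) f + integral (K \<inter> L) f = integral K f + integral L f"
proof -
  let ?r = "\<lambda>S x. if x \<in> S then f x else 0"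
  have "integral UNIV (?r (K \<union> L)) + integral UNIV (?r (K \<inter> L))
      = integral UNIV (\<lambda>x. ?r (K \<union> L) x + ?r (K \<inter> L) x)"
    using assms by (intro integral_add[symmetric]) (simp_all only: integrable_restrict_UNIV)
  also have "(\<lambda>x. ?r (K \<union> L) x + ?r (K \<inter> L) x) = (\<lambda>x. ?r K x + ?r L x)"
    by auto
  also have "integral UNIV \<dots> = integral UNIV (?r K) + integral UNIV (?r L)"
    using assms by (intro integral_add) (simp_all only: integrable_restrict_UNIV)
  finally show ?thesis by (simp only: Henstock_Kurzweil_Integration.integral_restrict_UNIV)
qed

lemma integrable_monomial:
  assumes "P \<in> polygons_o"
  shows "(\<lambda>x. x $ i * x $ j) integrable_on P"
  by (intro set_lebesgue_integral_eq_integral(1) absolutely_integrable_continuous_compact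
      polygons_oD(5)[OF assms] continuous_intros)

lemma covariant_valuation_moment_matrix: "covariant_valuation moment_matrix"
proof
  show "is_valuation_on polygons_o moment_matrix"
    unfolding is_valuation_on_def
    by (auto simp: vec_eq_iff moment_matrix_def intro!: integral_Un_Int integrable_monomial)
  fix P and \<phi> :: "real^2^2" assume P: "P \<in> polygons_o" and \<phi>: "invertible \<phi>"
  have Q: "(*v) \<phi> ` P \<in> polygons_o" by (rule polygons_o_image[OF P \<phi>])
  have comp: "moment_matrix ((*v) \<phi> ` P) $ i $ j
      = \<bar>det \<phi>\<bar> * integral P (\<lambda>x. (\<phi> *v x) $ i * (\<phi> *v x) $ j)" for i j
  proof -
    \<comment> \<open>The change of variables is done for a whole row of the matrix, from which
      entry \<open>j\<close> is read off.\<close>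
    let ?f = "\<lambda>x::real^2. x $ i *\<^sub>R x"
    have f: "?f absolutely_integrable_on (*v) \<phi> ` P"
      by (intro absolutely_integrable_continuous_compact polygons_oD(5)[OF Q] continuous_intros)
    have "(?f \<circ> (*v) \<phi>) absolutely_integrable_on P"
      unfolding comp_def
      by (intro absolutely_integrable_continuous_compact polygons_oD(5)[OF P] continuous_intros)
    then have g: "(?f \<circ> (*v) \<phi>) integrable_on P" by (rule set_lebesgue_integral_eq_integral(1))
    have "integral ((*v) \<phi> ` P) ?f = \<bar>det \<phi>\<bar> *\<^sub>R integral P (?f \<circ> (*v) \<phi>)"
      using integral_change_of_variables_linear[of "(*v) \<phi>" P ?f] f by simp
    then have "integral ((*v) \<phi> ` P) ?f $ j = \<bar>det \<phi>\<bar> * integral P (?f \<circ> (*v) \<phi>) $ j" by simp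
    then show ?thesis
      using integral_component_eq_cart[OF g, of j]
        integral_component_eq_cart[OF set_lebesgue_integral_eq_integral(1)[OF f], of j]
      by (simp add: moment_matrix_def comp_def)
  qed
  have I: "integral P (\<lambda>x. (\<phi> *v x) $ i * (\<phi> *v x) $ j) =
      (\<phi> ** moment_matrix P ** transpose \<phi>) $ i $ j" for i j
  proof -
    note hi = integrable_integral[OF integrable_monomial[OF P]]
    have "((\<lambda>x. \<phi>$i$1 * \<phi>$j$1 * (x$1 * x$1) + \<phi>$i$1 * \<phi>$j$2 * (x$1 * x$2)
        + \<phi>$i$2 * \<phi>$j$1 * (x$2 * x$1) + \<phi>$i$2 * \<phi>$j$2 * (x$2 * x$2)) has_integral
        (\<phi>$i$1 * \<phi>$j$1 * integral P (\<lambda>x. x$1 * x$1) + \<phi>$i$1 * \<phi>$j$2 * integral P (\<lambda>x. x$1 * x$2)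
        + \<phi>$i$2 * \<phi>$j$1 * integral P (\<lambda>x. x$2 * x$1) + \<phi>$i$2 * \<phi>$j$2 * integral P (\<lambda>x. x$2 * x$2))) P"
      by (intro has_integral_add has_integral_mult_right hi)
    moreover have "(\<lambda>x. (\<phi> *v x) $ i * (\<phi> *v x) $ j) =
      (\<lambda>x. \<phi>$i$1 * \<phi>$j$1 * (x$1 * x$1) + \<phi>$i$1 * \<phi>$j$2 * (x$1 * x$2)
        + \<phi>$i$2 * \<phi>$j$1 * (x$2 * x$1) + \<phi>$i$2 * \<phi>$j$2 * (x$2 * x$2))"
      by (simp add: fun_eq_iff matrix_vector_mult_2 algebra_simps)
    ultimately show ?thesis
      by (simp add: integral_unique conjugate_2 moment_matrix_def algebra_simps)
  qed
  show "moment_matrix ((*v) \<phi> ` P) = \<bar>det \<phi>\<bar> *\<^sub>R (\<phi> ** moment_matrix P ** transpose \<phi>)"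
    by (simp add: vec_eq_iff comp I)
qed

lemma moment_matrix_nonzero: "\<exists>P\<in>polygons_o. moment_matrix P \<noteq> 0"
proof (intro bexI notI)
  let ?Q = "cbox (- 1) 1 :: (real^2) set"
  show Q: "?Q \<in> polygons_o"
    by (simp add: polygons_o_def polytope_interval mem_box_cart)
  assume "moment_matrix ?Q = 0"
  then have "moment_matrix ?Q $ 1 $ 1 = 0" by simp
  then have "((\<lambda>x. x $ 1 * x $ 1) has_integral 0) ?Q"
    using integrable_integral[OF integrable_monomial[OF Q, of 1 1]] by (simp add: moment_matrix_def)
  \<comment> \<open>A nonnegative continuous integrand with integral 0 vanishes on the whole box, in
    particular at the corner \<open>1\<close>.\<close>
  then have "(1 :: real^2) $ 1 * (1 :: real^2) $ 1 = 0"
    by (rule has_integral_0_cbox_imp_0[rotated 2])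
       (auto intro!: continuous_intros simp: mem_box_cart interval_ne_empty_cart)
  then show False by simp
qed

text \<open>The second assumption says that the free parameter, an entry of
  \<open>ear_cut (1/2) 1\<close>, vanishes; it is spelled out for use outside the locale.\<close>

lemma covariant_valuation_eq_0:
  assumes "covariant_valuation \<nu>"
    and "(\<nu> (ear_polygon (1/2) 1) - \<nu> (ear_polygon (1/2) 1 \<inter> halfplane 1)) $ 1 $ 1 = 0"
    and "P \<in> polygons_o"
  shows "\<nu> P = 0"
proof -
  interpret covariant_valuation \<nu> by fact
  interpret ear_null_valuation \<nu>
    by unfold_locales (rule ear_cut_eq_0, use assms(2) in \<open>simp_all add: ear_cut_def cut_def\<close>)
  show ?thesis by (rule eq_0[OF assms(3)])
qed

section \<open>Subtracting a multiple of the moment matrix\<close>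

lemma covariant_valuation_diff:
  assumes "covariant_valuation \<nu>" "covariant_valuation \<nu>'"
  shows "covariant_valuation (\<lambda>P. \<nu> P - k *\<^sub>R \<nu>' P)"
proof -
  interpret \<nu>: covariant_valuation \<nu> by fact
  interpret \<nu>': covariant_valuation \<nu>' by fact
  show ?thesis
  proof
    show "is_valuation_on polygons_o (\<lambda>P. \<nu> P - k *\<^sub>R \<nu>' P)"
      unfolding is_valuation_on_def
    proof (intro allI impI)
      fix K L :: "(real^2) set"
      assume KL: "K \<in> polygons_o" "L \<in> polygons_o" "K \<union> L \<in> polygons_o" "K \<inter> L \<in> polygons_o"
      have "k *\<^sub>R \<nu>' (K \<union> L) + k *\<^sub>R \<nu>' (K \<inter> L) = k *\<^sub>R \<nu>' K + k *\<^sub>R \<nu>' L"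
        using \<nu>'.valuationD[OF KL] by (metis scaleR_add_right)
      then show "\<nu> (K \<union> L) - k *\<^sub>R \<nu>' (K \<union> L) + (\<nu> (K \<inter> L) - k *\<^sub>R \<nu>' (K \<inter> L)) =
          \<nu> K - k *\<^sub>R \<nu>' K + (\<nu> L - k *\<^sub>R \<nu>' L)"
        using \<nu>.valuationD[OF KL] by (simp add: algebra_simps)
    qed
    show "\<nu> ((*v) \<phi> ` P) - k *\<^sub>R \<nu>' ((*v) \<phi> ` P)
        = \<bar>det \<phi>\<bar> *\<^sub>R (\<phi> ** (\<nu> P - k *\<^sub>R \<nu>' P) ** transpose \<phi>)"
      if "P \<in> polygons_o" "invertible \<phi>" for P \<phi>
      using that
      by (simp add: \<nu>.covariant \<nu>'.covariant vec_eq_iff conjugate_2 algebra_simps)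
  qed
qed

theorem theorem3p13:
  fixes \<mu> :: "(real^2) set \<Rightarrow> real^2^2"
  assumes "\<mu> \<in> borel_measurable polygons_o_borel"
    and "is_valuation_on polygons_o \<mu>"
    and "GL2_contravariant \<mu>"
  shows "\<exists>k::real. \<forall>P\<in>polygons_o. \<mu> P = k *\<^sub>R moment_matrix (polar_body P)"
proof -
  define \<nu> where "\<nu> P = \<mu> (polar_body P)" for P
  have \<nu>: "covariant_valuation \<nu>"
    unfolding \<nu>_def by (rule covariant_valuation_polar[OF assms(2,3)])
  \<comment> \<open>\<open>l\<close> reads off the free parameter and is linear in the
    valuation.\<close>
  define l where "l f = (f (ear_polygon (1/2) 1) - f (ear_polygon (1/2) 1 \<inter> halfplane 1)) $ 1 $ 1"
    for f :: "(real^2) set \<Rightarrow> real^2^2"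
  define k where "k = l \<nu> / l moment_matrix"
  \<comment> \<open>If it were 0, the moment matrix would vanish on every polygon; no integral over
    a triangle has to be computed.\<close>
  have "l moment_matrix \<noteq> 0"
    using covariant_valuation_eq_0[OF covariant_valuation_moment_matrix] moment_matrix_nonzero
    unfolding l_def by blast
  then have "l (\<lambda>P. \<nu> P - k *\<^sub>R moment_matrix P) = 0"
    by (simp add: k_def l_def field_simps)
  then have eq: "\<nu> P = k *\<^sub>R moment_matrix P" if "P \<in> polygons_o" for P
    using covariant_valuation_eq_0[OF
        covariant_valuation_diff[OF \<nu> covariant_valuation_moment_matrix, of k] _ that]
    unfolding l_def by simp
  have "\<mu> P = k *\<^sub>R moment_matrix (polar_body P)" if "P \<in> polygons_o" for P
    using eq[OF polar_body_polygons_o[OF that]] by (simp add: \<nu>_def polar_polar[OF that])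
  then show ?thesis by blast
qed

end
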